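(* Let $W_\Gamma$ be a $2$-dimensional right-angled Coxeter group. Then every Coxeter subgroup of $W_\Gamma$ whose defining graph does not have an isolated vertex is quasiconvex in $W_\Gamma$.
   Context: For a finite simplicial graph $\Gamma$, $W_\Gamma=\langle V(\Gamma)\mid s^2=1 \ (s\in V(\Gamma)),\ st=ts \text{ if } s,t \text{ are adjacent}\rangle$ is the right-angled Coxeter group with defining graph $\Gamma$; it is $2$-dimensional if $\Gamma$ is triangle-free. A Coxeter subgroup of $W_\Gamma$ is a subgroup isomorphic to some finitely generated Coxeter group; such a subgroup is necessarily isomorphic to $W_{\Gamma'}$ for some finite simplicial graph $\Gamma'$ (unique up to isomorphism), its defining graph. An isolated vertex is a vertex not adjacent to any other vertex. A subgroup $G<W_\Gamma$ is quasiconvex if there is $M\ge0$ such that every geodesic with endpoints in $G$ in the Cayley graph of $W_\Gamma$ with respect to $V(\Gamma)$ lies in the $M$-neighborhood of $G$. *)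

theory Defs
  imports "HOL-Algebra.Group" "Graph_Theory.Pair_Digraph" "Graph_Theory.Shortest_Path"
begin

section \<open>Group presentations\<close>

text \<open>The letter \<open>(s, True)\<close> stands for \<open>s\<close> and \<open>(s, False)\<close> for its formal inverse.\<close>

type_synonym 's word = "('s \<times> bool) list"

abbreviation words :: "'s set \<Rightarrow> 's word set" where
  "words S \<equiv> lists (S \<times> UNIV)"

definition positive_word :: "'s list \<Rightarrow> 's word" where
  "positive_word w = map (\<lambda>s. (s, True)) w"

text \<open>The congruence on words over \<open>S\<close> generated by free cancellation and the relations
  \<open>l = r\<close> for \<open>(l, r) \<in> R\<close>.\<close>

inductive pres_eq :: "'s set \<Rightarrow> ('s word \<times> 's word) set \<Rightarrow> 's word \<Rightarrow> 's word \<Rightarrow> bool"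
  for S :: "'s set" and R :: "('s word \<times> 's word) set" where
  refl: "w \<in> words S \<Longrightarrow> pres_eq S R w w"
| sym: "pres_eq S R v w \<Longrightarrow> pres_eq S R w v"
| trans: "pres_eq S R u v \<Longrightarrow> pres_eq S R v w \<Longrightarrow> pres_eq S R u w"
| cancel: "u \<in> words S \<Longrightarrow> v \<in> words S \<Longrightarrow> s \<in> S \<Longrightarrow>
    pres_eq S R (u @ [(s, b), (s, \<not> b)] @ v) (u @ v)"
| relation: "(l, r) \<in> R \<Longrightarrow> u \<in> words S \<Longrightarrow> v \<in> words S \<Longrightarrow> l \<in> words S \<Longrightarrow> r \<in> words S \<Longrightarrow>
    pres_eq S R (u @ l @ v) (u @ r @ v)"

definition pres_rel :: "'s set \<Rightarrow> ('s word \<times> 's word) set \<Rightarrow> 's word rel" where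
  "pres_rel S R = {(v, w). pres_eq S R v w}"

definition presented_group :: "'s set \<Rightarrow> ('s word \<times> 's word) set \<Rightarrow> 's word set monoid" where
  "presented_group S R =
    \<lparr>carrier = words S // pres_rel S R,
     monoid.mult = (\<lambda>A B. \<Union>a\<in>A. \<Union>b\<in>B. pres_rel S R `` {a @ b}),
     one = pres_rel S R `` {[]}\<rparr>"

definition generators :: "'s set \<Rightarrow> ('s word \<times> 's word) set \<Rightarrow> 's word set set" where
  "generators S R = (\<lambda>s. pres_rel S R `` {[(s, True)]}) ` S"

lemma pres_eq_words: "pres_eq S R v w \<Longrightarrow> v \<in> words S \<and> w \<in> words S"
  by (induction rule: pres_eq.induct) auto

lemma pres_eq_context:
  "pres_eq S R v w \<Longrightarrow> x \<in> words S \<Longrightarrow> y \<in> words S \<Longrightarrow> pres_eq S R (x @ v @ y) (x @ w @ y)"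
proof (induction rule: pres_eq.induct)
  case (refl w)
  then show ?case by (intro pres_eq.refl) auto
next
  case (cancel u v s b)
  then show ?case using pres_eq.cancel[of "x @ u" S "v @ y" s R b] by auto
next
  case (relation l r u v)
  then show ?case using pres_eq.relation[of l r R "x @ u" S "v @ y"] by auto
next
  case (sym v w)
  then show ?case by (simp add: pres_eq.sym)
next
  case (trans u v w)
  then show ?case using pres_eq.trans by metis
qed

lemma pres_eq_append:
  assumes "pres_eq S R a b" "pres_eq S R c d"
  shows "pres_eq S R (a @ c) (b @ d)"
proof (rule pres_eq.trans)
  show "pres_eq S R (a @ c) (b @ c)"
    using pres_eq_context[OF assms(1), of "[]" c] pres_eq_words[OF assms(2)] by simp
  show "pres_eq S R (b @ c) (b @ d)"
    using pres_eq_context[OF assms(2), of b "[]"] pres_eq_words[OF assms(1)] by simp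
qed

lemma equiv_pres_rel: "equiv (words S) (pres_rel S R)"
proof (rule equivI)
  show "pres_rel S R \<subseteq> words S \<times> words S"
    using pres_eq_words unfolding pres_rel_def by blast
  show "refl_on (words S) (pres_rel S R)"
    by (simp add: refl_on_def pres_rel_def pres_eq.refl)
  show "sym (pres_rel S R)"
    by (simp add: sym_def pres_rel_def pres_eq.sym)
  show "trans (pres_rel S R)"
    unfolding trans_def pres_rel_def using pres_eq.trans by fast
qed

lemma pres_class_eq_iff:
  assumes "v \<in> words S" "w \<in> words S"
  shows "pres_rel S R `` {v} = pres_rel S R `` {w} \<longleftrightarrow> pres_eq S R v w"
  using eq_equiv_class_iff[OF equiv_pres_rel assms] by (simp add: pres_rel_def)

lemma presented_group_mult:
  assumes "v \<in> words S" "w \<in> words S"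
  shows "(pres_rel S R `` {v}) \<otimes>\<^bsub>presented_group S R\<^esub> (pres_rel S R `` {w}) =
    pres_rel S R `` {v @ w}"
proof -
  have "pres_rel S R `` {a @ b} = pres_rel S R `` {v @ w}"
    if "a \<in> pres_rel S R `` {v}" "b \<in> pres_rel S R `` {w}" for a b
  proof -
    have "pres_eq S R (v @ w) (a @ b)"
      using that by (intro pres_eq_append) (simp_all add: pres_rel_def)
    then show ?thesis
      using pres_class_eq_iff[of "v @ w" S "a @ b" R] pres_eq_words[of S R "v @ w" "a @ b"]
      by metis
  qed
  then have "(\<Union>a\<in>pres_rel S R `` {v}. \<Union>b\<in>pres_rel S R `` {w}. pres_rel S R `` {a @ b}) =
      (\<Union>a\<in>pres_rel S R `` {v}. \<Union>b\<in>pres_rel S R `` {w}. pres_rel S R `` {v @ w})"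
    by (intro SUP_cong HOL.refl)
  moreover have "v \<in> pres_rel S R `` {v}" "w \<in> pres_rel S R `` {w}"
    using assms by (auto simp: pres_rel_def intro: pres_eq.refl)
  ultimately show ?thesis
    by (auto simp only: presented_group_def monoid.simps partial_object.simps UN_constant split: if_splits)
qed

lemma pres_eq_inverse:
  "w \<in> words S \<Longrightarrow> pres_eq S R (rev (map (apsnd Not) w) @ w) []"
proof (induction w)
  case (Cons x w)
  obtain s b where x: "x = (s, b)" by force
  let ?w = "rev (map (apsnd Not) w)"
  have "?w \<in> words S" using Cons.prems by (force simp: in_lists_conv_set)
  then have "pres_eq S R (?w @ [(s, \<not> b), (s, \<not> \<not> b)] @ w) (?w @ w)"
    using Cons.prems x by (intro pres_eq.cancel) auto
  moreover have "pres_eq S R (?w @ w) []" using Cons by auto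
  ultimately have "pres_eq S R (?w @ [(s, \<not> b), (s, \<not> \<not> b)] @ w) []" by (rule pres_eq.trans)
  then show ?case by (simp add: x)
qed (simp add: pres_eq.refl)

lemma group_presented_group: "Group.group (presented_group S R)"
proof (rule groupI)
  have carr: "carrier (presented_group S R) = (\<lambda>w. pres_rel S R `` {w}) ` words S"
    by (auto simp: presented_group_def quotient_def)
  have one: "\<one>\<^bsub>presented_group S R\<^esub> = pres_rel S R `` {[]}"
    by (simp add: presented_group_def)
  show "\<one>\<^bsub>presented_group S R\<^esub> \<in> carrier (presented_group S R)"
    by (auto simp: carr one)
  fix x assume "x \<in> carrier (presented_group S R)"
  then obtain u where u: "u \<in> words S" "x = pres_rel S R `` {u}" by (auto simp: carr)
  show "\<one>\<^bsub>presented_group S R\<^esub> \<otimes>\<^bsub>presented_group S R\<^esub> x = x"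
    using u presented_group_mult[of "[]" S u R] by (simp add: one)
  have inv: "rev (map (apsnd Not) u) \<in> words S"
    using u(1) by (force simp: in_lists_conv_set)
  show "\<exists>y\<in>carrier (presented_group S R). y \<otimes>\<^bsub>presented_group S R\<^esub> x = \<one>\<^bsub>presented_group S R\<^esub>"
    using presented_group_mult[OF inv u(1), of R] pres_eq_inverse[OF u(1), of R] u inv
      pres_class_eq_iff[of "rev (map (apsnd Not) u) @ u" S "[]" R]
    by (auto simp: carr one)
  fix y assume "y \<in> carrier (presented_group S R)"
  then obtain v where v: "v \<in> words S" "y = pres_rel S R `` {v}" by (auto simp: carr)
  show "x \<otimes>\<^bsub>presented_group S R\<^esub> y \<in> carrier (presented_group S R)"
    using u v by (auto simp: carr presented_group_mult)
  fix z assume "z \<in> carrier (presented_group S R)"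
  then obtain w where w: "w \<in> words S" "z = pres_rel S R `` {w}" by (auto simp: carr)
  show "x \<otimes>\<^bsub>presented_group S R\<^esub> y \<otimes>\<^bsub>presented_group S R\<^esub> z =
      x \<otimes>\<^bsub>presented_group S R\<^esub> (y \<otimes>\<^bsub>presented_group S R\<^esub> z)"
    using u v w by (simp add: presented_group_mult)
qed

section \<open>Coxeter groups\<close>

text \<open>Finite simplicial graphs are rendered as \<^locale>\<open>pair_graph\<close>: finite, loop-free, with a
  symmetric arc relation.\<close>

definition racg_relations :: "'v pair_pre_digraph \<Rightarrow> ('v word \<times> 'v word) set" where
  "racg_relations \<Gamma> =
    {(positive_word [s, s], []) | s. s \<in> pverts \<Gamma>} \<union>
    {(positive_word [s, t], positive_word [t, s]) | s t. (s, t) \<in> parcs \<Gamma>}"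

definition racg :: "'v pair_pre_digraph \<Rightarrow> 'v word set monoid" where
  "racg \<Gamma> = presented_group (pverts \<Gamma>) (racg_relations \<Gamma>)"

definition racg_generators :: "'v pair_pre_digraph \<Rightarrow> 'v word set set" where
  "racg_generators \<Gamma> = generators (pverts \<Gamma>) (racg_relations \<Gamma>)"

definition triangle_free :: "'v pair_pre_digraph \<Rightarrow> bool" where
  "triangle_free \<Gamma> \<longleftrightarrow>
    \<not> (\<exists>a b c. (a, b) \<in> parcs \<Gamma> \<and> (b, c) \<in> parcs \<Gamma> \<and> (a, c) \<in> parcs \<Gamma>)"

definition isolated_vertex :: "'v pair_pre_digraph \<Rightarrow> 'v \<Rightarrow> bool" where
  "isolated_vertex \<Gamma> v \<longleftrightarrow> v \<in> pverts \<Gamma> \<and> (\<forall>w. w \<noteq> v \<longrightarrow> (v, w) \<notin> parcs \<Gamma>)"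

text \<open>In a Coxeter matrix the entry \<open>0\<close> encodes \<open>\<infinity>\<close>; the relation \<open>(s t)\<^sup>0 = 1\<close> it
  contributes to the presentation is vacuous.\<close>

definition coxeter_matrix :: "'s set \<Rightarrow> ('s \<Rightarrow> 's \<Rightarrow> nat) \<Rightarrow> bool" where
  "coxeter_matrix S m \<longleftrightarrow>
    (\<forall>s\<in>S. m s s = 1) \<and> (\<forall>s\<in>S. \<forall>t\<in>S. m s t = m t s \<and> (s \<noteq> t \<longrightarrow> m s t \<noteq> 1))"

definition coxeter_group :: "'s set \<Rightarrow> ('s \<Rightarrow> 's \<Rightarrow> nat) \<Rightarrow> 's word set monoid" where
  "coxeter_group S m = presented_group S
    {(positive_word (concat (replicate (m s t) [s, t])), []) | s t. s \<in> S \<and> t \<in> S}"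

text \<open>A Coxeter group is finitely generated iff its Coxeter generating set is finite, so that set
  may be taken to be an initial segment of the natural numbers.\<close>

definition coxeter_subgroup :: "('a, 'b) monoid_scheme \<Rightarrow> 'a set \<Rightarrow> bool" where
  "coxeter_subgroup W H \<longleftrightarrow> subgroup H W \<and>
    (\<exists>n m. coxeter_matrix {..<n::nat} m \<and> W\<lparr>carrier := H\<rparr> \<cong> coxeter_group {..<n} m)"

definition defining_graph_of ::
  "'v pair_pre_digraph \<Rightarrow> ('a, 'b) monoid_scheme \<Rightarrow> 'a set \<Rightarrow> bool" where
  "defining_graph_of \<Delta> W H \<longleftrightarrow> pair_graph \<Delta> \<and> W\<lparr>carrier := H\<rparr> \<cong> racg \<Delta>"

section \<open>Quasiconvexity\<close>

definition cayley_graph :: "('a, 'b) monoid_scheme \<Rightarrow> 'a set \<Rightarrow> 'a pair_pre_digraph" where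
  "cayley_graph G S =
    \<lparr>pverts = carrier G,
     parcs = {(g, h). g \<in> carrier G \<and> h \<in> carrier G \<and>
       (\<exists>s\<in>S. h = g \<otimes>\<^bsub>G\<^esub> s \<or> g = h \<otimes>\<^bsub>G\<^esub> s)}\<rparr>"

text \<open>\<open>wf_digraph.\<mu>\<close> is only specified on well-formed digraphs, which Cayley graphs are.\<close>

lemma pair_wf_digraph_cayley_graph: "pair_wf_digraph (cayley_graph G S)"
  by unfold_locales (auto simp: cayley_graph_def)

definition graph_dist :: "'a pair_pre_digraph \<Rightarrow> 'a \<Rightarrow> 'a \<Rightarrow> ereal" where
  "graph_dist C x y = wf_digraph.\<mu> (with_proj C) (\<lambda>_. 1) x y"

definition geodesic :: "'a pair_pre_digraph \<Rightarrow> 'a \<Rightarrow> ('a \<times> 'a) awalk \<Rightarrow> 'a \<Rightarrow> bool" where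
  "geodesic C x p y \<longleftrightarrow>
    pre_digraph.awalk (with_proj C) x p y \<and> ereal (real (length p)) = graph_dist C x y"

definition quasiconvex :: "('a, 'b) monoid_scheme \<Rightarrow> 'a set \<Rightarrow> 'a set \<Rightarrow> bool" where
  "quasiconvex G S H \<longleftrightarrow>
    (\<exists>M::real. M \<ge> 0 \<and>
      (\<forall>x\<in>H. \<forall>y\<in>H. \<forall>p. geodesic (cayley_graph G S) x p y \<longrightarrow>
        (\<forall>z\<in>set (pawalk_verts x p). \<exists>h\<in>H. graph_dist (cayley_graph G S) z h \<le> ereal M)))"

end

theory Submission
  imports Defs "HOL-Algebra.Generated_Groups"
begin

text \<open>
  Write \<open>W\<close> for the ambient group and call the conjugates of its generators reflections. The proof
  has two halves: \<open>H\<close> is generated by finitely many reflections of \<open>W\<close>, and a subgroup generated by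
  finitely many reflections of any right-angled Coxeter group is quasiconvex.

  For the first half, an involution of \<open>W\<close> is conjugate to a product of pairwise commuting
  generators, so in dimension two it is either a reflection or conjugate to a product \<open>s t\<close> of two
  commuting generators. In the second case its centralizer is conjugate to \<open>{1, s, t, s t}\<close>,
  because a further commuting generator would complete a triangle. If the image \<open>x\<close> of a vertex of
  \<open>\<Delta>\<close> is of the second kind, then the image \<open>y\<close> of a neighbouring vertex lies in that centralizer,
  so \<open>y\<close> and \<open>x y\<close> are reflections in \<open>H\<close> with product \<open>x\<close>. Hence every generator of \<open>H\<close>
  is a product of reflections in \<open>H\<close> (\<open>reflection_or_neighbour_reflection\<close>,
  \<open>generated_by_reflections\<close>). An isolated vertex could be sent to a product \<open>s t\<close> without any
  reflection in \<open>H\<close> to replace it, which is why isolated vertices are excluded.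

  For the second half, each reflection is thought of as a wall in the Cayley graph: a path crosses
  a wall at each edge that the reflection inverts, and the parity of the number of crossings depends
  only on the endpoints. The word metric counts the walls separating two elements. The one
  geometric input that is special to right-angled groups is
  \<open>noncommuting_empty_quadrant\<close>: two walls whose reflections do not commute do not cross, so
  one of their four quadrants is empty.

  Generating reflections of \<open>H\<close> that lie as close to \<open>1\<close> as possible are pairwise commuting or
  facing: their walls bound disjoint half-spaces not containing \<open>1\<close> (\<open>facing_generators_exist\<close>).
  Every vertex is then \<open>h d\<close> with \<open>h\<close> in \<open>H\<close> and \<open>d\<close> on the same side as \<open>1\<close> of every
  generating wall. If \<open>h d\<close> lies on a geodesic with endpoints in \<open>H\<close>, a wall separating \<open>1\<close> from \<open>d\<close>
  must also separate \<open>1\<close> from some element of \<open>H\<close>. Such a wall cannot cross all the generating walls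
  on the way to this element, so it is trapped in front of the first one that it does not cross
  and separates \<open>1\<close> from that generator (\<open>separating_wall_near_generator\<close>). There are only
  finitely many such walls, and their number bounds the distance from \<open>h d\<close> to \<open>H\<close>.
\<close>

section \<open>Words, their walls, and right-angled Coxeter systems\<close>

definition word_value :: "('a, 'b) monoid_scheme \<Rightarrow> 'a list \<Rightarrow> 'a" where
  "word_value G w = foldr (monoid.mult G) w \<one>\<^bsub>G\<^esub>"

text \<open>The equivalence of words generated by cancelling a repeated letter and by transposing adjacent
  letters that commute in \<open>G\<close>. Commutation is tested in the group and not in a graph, so that the
  relation makes sense for any set of involutions.\<close>

inductive shuffle_equiv :: "('a, 'b) monoid_scheme \<Rightarrow> 'a set \<Rightarrow> 'a list \<Rightarrow> 'a list \<Rightarrow> bool"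
  for G S where
  shuffle_refl: "w \<in> lists S \<Longrightarrow> shuffle_equiv G S w w"
| shuffle_sym: "shuffle_equiv G S u v \<Longrightarrow> shuffle_equiv G S v u"
| shuffle_trans: "shuffle_equiv G S u v \<Longrightarrow> shuffle_equiv G S v w \<Longrightarrow> shuffle_equiv G S u w"
| shuffle_cancel: "u \<in> lists S \<Longrightarrow> v \<in> lists S \<Longrightarrow> s \<in> S \<Longrightarrow>
    shuffle_equiv G S (u @ [s, s] @ v) (u @ v)"
| shuffle_swap: "u \<in> lists S \<Longrightarrow> v \<in> lists S \<Longrightarrow> s \<in> S \<Longrightarrow> t \<in> S \<Longrightarrow>
    s \<otimes>\<^bsub>G\<^esub> t = t \<otimes>\<^bsub>G\<^esub> s \<Longrightarrow> shuffle_equiv G S (u @ [s, t] @ v) (u @ [t, s] @ v)"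

text \<open>Letting each letter of a word act on an auxiliary set is the source of all invariants below:
  with \<open>f\<close> taking values in commuting involutions it counts letters modulo two, and with values in an
  infinite dihedral group it records the order in which two kinds of letters occur.\<close>

definition compose_along :: "('a \<Rightarrow> 'x \<Rightarrow> 'x) \<Rightarrow> 'a list \<Rightarrow> 'x \<Rightarrow> 'x" where
  "compose_along f ts = foldr (\<circ>) (map f ts) id"

lemma compose_along_simps [simp]:
  "compose_along f [] = id"
  "compose_along f (t # ts) = f t \<circ> compose_along f ts"
  by (simp_all add: compose_along_def)

lemma compose_along_append [simp]:
  "compose_along f (us @ vs) = compose_along f us \<circ> compose_along f vs"
  by (induction us) (simp_all add: comp_assoc)

lemma compose_along_two_involutions:
  assumes "distinct ts" "K \<noteq> T"
  shows "compose_along (\<lambda>t. if t = K then a else if t = T then b else id) ts \<in>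
    (if K \<in> set ts then if T \<in> set ts then {a \<circ> b, b \<circ> a} else {a}
     else if T \<in> set ts then {b} else {id})"
  using assms by (induction ts) (auto split: if_splits)

lemma odd_count_list_mem: "odd (count_list xs x) \<Longrightarrow> x \<in> set xs"
  by (metis count_notin even_zero)

lemma count_list_map_inj:
  assumes "inj_on h A" "set xs \<subseteq> A" "x \<in> A"
  shows "count_list (map h xs) (h x) = count_list xs x"
  using assms by (induction xs) (auto dest: inj_onD)

text \<open>The last assumption says that the commutations between generators and the relations \<open>s\<^sup>2 = 1\<close>
  present the group.\<close>

locale right_angled_coxeter_system = Group.group G for G (structure) +
  fixes S :: "'a set"
  assumes gens_carrier: "S \<subseteq> carrier G"
    and gens_square: "s \<in> S \<Longrightarrow> s \<otimes> s = \<one>"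
    and gens_generate: "g \<in> carrier G \<Longrightarrow> \<exists>w\<in>lists S. word_value G w = g"
    and presentation: "u \<in> lists S \<Longrightarrow> v \<in> lists S \<Longrightarrow> word_value G u = word_value G v \<Longrightarrow>
      shuffle_equiv G S u v"
begin

lemma gen_closed [simp]: "s \<in> S \<Longrightarrow> s \<in> carrier G"
  using gens_carrier by blast

lemma word_value_simps [simp]:
  "word_value G [] = \<one>" "word_value G (s # w) = s \<otimes> word_value G w"
  by (simp_all add: word_value_def)

lemma word_value_closed [simp]: "w \<in> lists (carrier G) \<Longrightarrow> word_value G w \<in> carrier G"
  by (induction w) auto

lemma gens_word_carrier [simp]: "w \<in> lists S \<Longrightarrow> w \<in> lists (carrier G)"
  using gens_carrier by auto

lemma word_value_append [simp]:
  "u \<in> lists (carrier G) \<Longrightarrow> v \<in> lists (carrier G) \<Longrightarrow>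
    word_value G (u @ v) = word_value G u \<otimes> word_value G v"
  by (induction u) (simp_all add: m_assoc)

definition conjugate :: "'a \<Rightarrow> 'a \<Rightarrow> 'a" where
  "conjugate x t = x \<otimes> t \<otimes> inv x"

lemma conjugate_closed [simp]: "x \<in> carrier G \<Longrightarrow> t \<in> carrier G \<Longrightarrow> conjugate x t \<in> carrier G"
  by (simp add: conjugate_def)

lemma conjugate_one [simp]: "t \<in> carrier G \<Longrightarrow> conjugate \<one> t = t"
  by (simp add: conjugate_def)

lemma conjugate_conjugate:
  "x \<in> carrier G \<Longrightarrow> y \<in> carrier G \<Longrightarrow> t \<in> carrier G \<Longrightarrow> conjugate x (conjugate y t) = conjugate (x \<otimes> y) t"
  by (simp add: conjugate_def inv_mult_group m_assoc)

lemma conjugate_inv_conjugate [simp]: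
  assumes "x \<in> carrier G" "t \<in> carrier G"
  shows "conjugate (inv x) (conjugate x t) = t" "conjugate x (conjugate (inv x) t) = t"
  using assms by (simp_all add: conjugate_conjugate)

lemma conjugate_inj: "x \<in> carrier G \<Longrightarrow> inj_on (conjugate x) (carrier G)"
  by (metis conjugate_inv_conjugate(1) inj_onI)

lemma conjugate_mult:
  assumes "x \<in> carrier G" "s \<in> carrier G" "t \<in> carrier G"
  shows "conjugate x (s \<otimes> t) = conjugate x s \<otimes> conjugate x t"
proof -
  have "inv x \<otimes> (x \<otimes> (t \<otimes> inv x)) = t \<otimes> inv x"
    using assms by (simp flip: m_assoc)
  then show ?thesis using assms by (simp add: conjugate_def m_assoc)
qed

lemma conjugate_eq_self_iff:
  assumes "x \<in> carrier G" "t \<in> carrier G"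
  shows "conjugate x t = t \<longleftrightarrow> x \<otimes> t = t \<otimes> x"
  using assms by (metis conjugate_def inv_solve_right' m_closed)

lemma conjugate_times: "x \<in> carrier G \<Longrightarrow> t \<in> carrier G \<Longrightarrow> conjugate x t \<otimes> x = x \<otimes> t"
  by (simp add: conjugate_def m_assoc)

text \<open>The path that spells \<open>s\<^sub>1 \<dots> s\<^sub>n\<close> from \<open>1\<close> crosses, at its \<open>i\<close>-th edge, the wall of the reflection
  \<open>g s\<^sub>i g\<inverse>\<close> with \<open>g = s\<^sub>1 \<dots> s\<^bsub>i-1\<^esub>\<close>; these reflections are listed in order.\<close>

primrec walls :: "'a list \<Rightarrow> 'a list" where
  "walls [] = []"
| "walls (s # w) = s # map (conjugate s) (walls w)"

lemma length_walls [simp]: "length (walls w) = length w"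
  by (induction w) auto

lemma walls_closed: "w \<in> lists (carrier G) \<Longrightarrow> set (walls w) \<subseteq> carrier G"
  by (induction w) auto

lemma walls_append:
  assumes "u \<in> lists (carrier G)" "v \<in> lists (carrier G)"
  shows "walls (u @ v) = walls u @ map (conjugate (word_value G u)) (walls v)"
  using assms
proof (induction u rule: list.induct)
  case Nil
  have "map (conjugate \<one>) (walls v) = walls v"
    using walls_closed[OF assms(2)] by (intro map_idI) auto
  then show ?case by simp
next
  case (Cons s u)
  have "conjugate s (conjugate (word_value G u) t) = conjugate (s \<otimes> word_value G u) t" if "t \<in> set (walls v)" for t
    using that Cons.prems walls_closed[OF assms(2)] by (simp add: conjugate_conjugate subset_iff)
  then have "map (conjugate s \<circ> conjugate (word_value G u)) (walls v) = map (conjugate (s \<otimes> word_value G u)) (walls v)"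
    by simp
  with Cons show ?case by simp
qed

text \<open>An elementary shuffle changes the list of crossed walls very little: cancelling \<open>s s\<close> removes two
  consecutive equal walls, and transposing commuting letters transposes two consecutive walls with
  commuting reflections. Any \<open>f\<close> that respects these two changes therefore gives an invariant of the
  group element.\<close>

lemma compose_along_walls_invariant:
  assumes square: "\<And>t. t \<in> carrier G \<Longrightarrow> f t \<circ> f t = id"
    and commute: "\<And>t t'. t \<in> carrier G \<Longrightarrow> t' \<in> carrier G \<Longrightarrow> t \<otimes> t' = t' \<otimes> t \<Longrightarrow>
      f t \<circ> f t' = f t' \<circ> f t"
    and "u \<in> lists S" "v \<in> lists S" "word_value G u = word_value G v"
  shows "compose_along f (walls u) = compose_along f (walls v)"
proof -
  have "shuffle_equiv G S u v" using assms presentation by blast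
  then show ?thesis
  proof induction
    case (shuffle_cancel u v s)
    define x where "x = word_value G u"
    have x: "x \<in> carrier G" using shuffle_cancel by (simp add: x_def)
    have c: "[s, s] @ v \<in> lists (carrier G)" "[s, s] \<in> lists (carrier G)" using shuffle_cancel by auto
    have "walls ([s, s] @ v) = [s, s] @ walls v"
      using shuffle_cancel c walls_closed[of v] conjugate_eq_self_iff[of s s]
      by (subst walls_append) (auto simp: gens_square intro!: map_idI)
    then have "walls (u @ [s, s] @ v) = walls u @ [conjugate x s, conjugate x s] @ map (conjugate x) (walls v)"
      using shuffle_cancel c by (subst walls_append) (auto simp: x_def)
    moreover have "walls (u @ v) = walls u @ map (conjugate x) (walls v)"
      using shuffle_cancel by (subst walls_append) (auto simp: x_def)
    moreover have "f (conjugate x s) (f (conjugate x s) y) = y" for y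
      using square[of "conjugate x s"] x shuffle_cancel by (simp add: fun_eq_iff)
    ultimately show ?case by (simp add: fun_eq_iff)
  next
    case (shuffle_swap u v s t)
    define x where "x = word_value G u"
    have x: "x \<in> carrier G" using shuffle_swap by (simp add: x_def)
    have *: "walls (u @ [s, t] @ v) =
        walls u @ [conjugate x s, conjugate x t] @ map (conjugate x) (map (conjugate (s \<otimes> t)) (walls v))"
      if "s \<in> S" "t \<in> S" "s \<otimes> t = t \<otimes> s" for s t
    proof -
      have c: "[s, t] @ v \<in> lists (carrier G)" "[s, t] \<in> lists (carrier G)"
        using shuffle_swap that by auto
      have "walls ([s, t] @ v) = [s, t] @ map (conjugate (s \<otimes> t)) (walls v)"
        using shuffle_swap that c conjugate_eq_self_iff[of s t] by (subst walls_append) auto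
      then show ?thesis
        using shuffle_swap c by (subst walls_append) (auto simp: x_def)
    qed
    have "f (conjugate x s) \<circ> f (conjugate x t) = f (conjugate x t) \<circ> f (conjugate x s)"
      using x shuffle_swap by (intro commute) (simp_all flip: conjugate_mult)
    then have "f (conjugate x s) (f (conjugate x t) y) = f (conjugate x t) (f (conjugate x s) y)" for y
      by (simp add: fun_eq_iff)
    with *[of s t] *[of t s] shuffle_swap show ?case by (simp add: fun_eq_iff)
  qed auto
qed

section \<open>Separating walls and word length\<close>

definition word_of :: "'a \<Rightarrow> 'a list" where
  "word_of g = (SOME w. w \<in> lists S \<and> word_value G w = g)"

lemma word_of: "g \<in> carrier G \<Longrightarrow> word_of g \<in> lists S \<and> word_value G (word_of g) = g"
  using gens_generate[of g] unfolding word_of_def by (metis (mono_tags, lifting) someI_ex)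

text \<open>The walls between \<open>1\<close> and \<open>g\<close>: those crossed an odd number of times by a path from \<open>1\<close> to \<open>g\<close>.\<close>

definition separating :: "'a \<Rightarrow> 'a set" where
  "separating g = {t. odd (count_list (walls (word_of g)) t)}"

text \<open>The parity of the crossings of a single wall \<open>t\<close> is an invariant of the kind above: \<open>t\<close> negates a
  Boolean, and every other wall fixes it.\<close>

lemma separating_word:
  assumes "w \<in> lists S"
  shows "separating (word_value G w) = {t. odd (count_list (walls w) t)}"
proof -
  have count: "compose_along (\<lambda>u. if u = t then Not else id) ts b = (b \<noteq> odd (count_list ts t))"
    for t :: 'a and ts b
    by (induction ts) auto
  have "odd (count_list (walls (word_of (word_value G w))) t) = odd (count_list (walls w) t)" for t
  proof -
    have "compose_along (\<lambda>u. if u = t then Not else id) (walls (word_of (word_value G w))) =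
        compose_along (\<lambda>u. if u = t then Not else id) (walls w)"
      using assms word_of[of "word_value G w"]
      by (intro compose_along_walls_invariant) (auto simp: fun_eq_iff)
    then have "compose_along (\<lambda>u. if u = t then Not else id) (walls (word_of (word_value G w))) False =
        compose_along (\<lambda>u. if u = t then Not else id) (walls w) False" by simp
    then show ?thesis by (simp only: count) simp
  qed
  then show ?thesis by (simp add: separating_def)
qed

lemma separating_one [simp]: "separating \<one> = {}"
  using separating_word[of "[]"] by simp

lemma separating_gen [simp]: "s \<in> S \<Longrightarrow> separating s = {s}"
  using separating_word[of "[s]"] by (auto split: if_splits)

lemma separating_finite [simp]: "finite (separating g)"
proof -
  have "separating g \<subseteq> set (walls (word_of g))"
    unfolding separating_def by (auto dest: odd_count_list_mem)
  then show ?thesis using finite_subset by blast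
qed

lemma separating_closed: "g \<in> carrier G \<Longrightarrow> separating g \<subseteq> carrier G"
proof
  fix t assume g: "g \<in> carrier G" "t \<in> separating g"
  then have "t \<in> set (walls (word_of g))"
    unfolding separating_def by (auto dest: odd_count_list_mem)
  then show "t \<in> carrier G" using walls_closed[of "word_of g"] word_of[of g] g by auto
qed

text \<open>Follow a path from \<open>1\<close> to \<open>x\<close>, and then the \<open>x\<close>-translate of a path from \<open>1\<close> to \<open>y\<close>.\<close>

lemma conjugate_mem_separating_mult:
  assumes "x \<in> carrier G" "y \<in> carrier G" "t \<in> carrier G"
  shows "conjugate x t \<in> separating (x \<otimes> y) \<longleftrightarrow> (conjugate x t \<in> separating x) \<noteq> (t \<in> separating y)"
proof -
  define u v where "u = word_of x" and "v = word_of y"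
  have uv: "u \<in> lists S" "v \<in> lists S" "word_value G u = x" "word_value G v = y"
    using word_of assms by (auto simp: u_def v_def)
  have "count_list (map (conjugate x) (walls v)) (conjugate x t) = count_list (walls v) t"
    using conjugate_inj[of x] assms walls_closed[of v] uv by (intro count_list_map_inj) auto
  moreover have "walls (u @ v) = walls u @ map (conjugate x) (walls v)"
    using uv by (subst walls_append) auto
  moreover have "word_value G (u @ v) = x \<otimes> y" using uv by simp
  ultimately show ?thesis
    using separating_word[of "u @ v"] separating_word[of u] separating_word[of v] uv by auto
qed

lemma gen_inv [simp]: "s \<in> S \<Longrightarrow> inv s = s"
  by (simp add: gens_square inv_equality)

lemma separating_subset_walls:
  "w \<in> lists S \<Longrightarrow> separating (word_value G w) \<subseteq> set (walls w)"
  by (auto simp: separating_word dest: odd_count_list_mem)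

lemma card_separating_word_le:
  assumes "w \<in> lists S"
  shows "card (separating (word_value G w)) \<le> length w"
  using card_mono[OF _ separating_subset_walls[OF assms]] card_length[of "walls w"] by simp

text \<open>Reflecting the part of a path after its crossing with the wall of \<open>t\<close> makes that crossing
  unnecessary: the corresponding letter can be deleted.\<close>

lemma exchange:
  assumes "w \<in> lists S" "t \<in> set (walls w)"
  shows "\<exists>w'\<in>lists S. word_value G w' = t \<otimes> word_value G w \<and> length w = Suc (length w')"
  using assms
proof (induction w arbitrary: t rule: list.induct)
  case (Cons s w)
  have w: "w \<in> lists S" "s \<in> S" using Cons.prems by auto
  show ?case
  proof (cases "t = s")
    case True
    have "s \<otimes> (s \<otimes> word_value G w) = word_value G w"
      using w by (simp add: gens_square flip: m_assoc)
    with True have "word_value G w = t \<otimes> word_value G (s # w) \<and> length (s # w) = Suc (length w)"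
      by simp
    with w(1) show ?thesis by blast
  next
    case False
    then obtain t' where t': "t = conjugate s t'" "t' \<in> set (walls w)" using Cons.prems by auto
    obtain w' where w': "w' \<in> lists S" "word_value G w' = t' \<otimes> word_value G w"
      "length w = Suc (length w')" using Cons.IH[OF w(1) t'(2)] by blast
    have c: "t' \<in> carrier G" using t' walls_closed[of w] w by auto
    have "s \<otimes> (t' \<otimes> word_value G w) = conjugate s t' \<otimes> (s \<otimes> word_value G w)"
      using c w conjugate_times[of s t'] by (simp flip: m_assoc)
    with w w' t' have "s # w' \<in> lists S \<and> word_value G (s # w') = t \<otimes> word_value G (s # w) \<and>
        length (s # w) = Suc (length (s # w'))" by simp
    then show ?thesis by blast
  qed
qed simp

lemma separating_distinct_walls:
  assumes "w \<in> lists S" "distinct (walls w)"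
  shows "separating (word_value G w) = set (walls w)"
proof -
  have "count_list ts t = (if t \<in> set ts then 1 else 0)" if "distinct ts" for ts and t :: 'a
    using that by (induction ts) auto
  then show ?thesis using assms by (simp add: separating_word)
qed

text \<open>A path that crosses a wall twice can be shortened by reflecting the part between the crossings.\<close>

lemma shortest_word_distinct_walls:
  assumes "w \<in> lists S" "\<And>v. v \<in> lists S \<Longrightarrow> word_value G v = word_value G w \<Longrightarrow> length w \<le> length v"
  shows "distinct (walls w)"
  using assms
proof (induction w rule: list.induct)
  case (Cons s w)
  have w: "w \<in> lists S" "s \<in> S" using Cons.prems by auto
  have "length w \<le> length v" if "v \<in> lists S" "word_value G v = word_value G w" for v
    using Cons.prems(2)[of "s # v"] that w by simp
  with Cons.IH w have d: "distinct (walls w)" by blast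
  have "s \<notin> set (walls w)"
  proof
    assume "s \<in> set (walls w)"
    then obtain v where v: "v \<in> lists S" "word_value G v = s \<otimes> word_value G w"
      "length w = Suc (length v)" using exchange[OF w(1)] by blast
    with Cons.prems(2)[of v] show False by simp
  qed
  moreover have "t = s" if "t \<in> set (walls w)" "conjugate s t = s" for t
  proof -
    have "t \<in> carrier G" using that w walls_closed[of w] by auto
    moreover have "conjugate s s = s" using w conjugate_eq_self_iff[of s s] by simp
    ultimately show ?thesis using that w inj_onD[OF conjugate_inj[of s], of t s] by simp
  qed
  ultimately have "s \<notin> conjugate s ` set (walls w)" by force
  moreover have "inj_on (conjugate s) (set (walls w))"
    using w walls_closed[of w] conjugate_inj[of s] inj_on_subset[of "conjugate s" "carrier G"] by auto
  ultimately show ?case using d by (simp add: distinct_map)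
qed simp

text \<open>Consequently the word length of \<open>g\<close> is the number of walls separating \<open>1\<close> from \<open>g\<close>, and this
  number replaces word length from here on.\<close>

lemma reduced_word:
  assumes "g \<in> carrier G"
  obtains w where "w \<in> lists S" "word_value G w = g" "distinct (walls w)"
    "set (walls w) = separating g" "length w = card (separating g)"
proof -
  have "word_of g \<in> lists S \<and> word_value G (word_of g) = g" using assms word_of by blast
  from ex_has_least_nat[where P = "\<lambda>w. w \<in> lists S \<and> word_value G w = g" and m = length, OF this]
  obtain w where w: "w \<in> lists S" "word_value G w = g"
    "\<And>v. v \<in> lists S \<Longrightarrow> word_value G v = g \<Longrightarrow> length w \<le> length v" by blast
  have d: "distinct (walls w)"
    by (rule shortest_word_distinct_walls) (use w in simp_all)
  then have "set (walls w) = separating g" using separating_distinct_walls[of w] w by simp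
  moreover from this have "length w = card (separating g)" using distinct_card[OF d] by simp
  ultimately show ?thesis using w(1,2) d by (intro that)
qed

lemma strong_exchange:
  assumes "g \<in> carrier G" "t \<in> separating g"
  shows "card (separating (t \<otimes> g)) < card (separating g)"
proof -
  obtain w where w: "w \<in> lists S" "word_value G w = g" "set (walls w) = separating g"
    "length w = card (separating g)" by (rule reduced_word[OF assms(1)])
  have "t \<in> set (walls w)" using assms w by simp
  then obtain v where v: "v \<in> lists S" "word_value G v = t \<otimes> g" "length w = Suc (length v)"
    using exchange[OF w(1)] w(2) by blast
  from card_separating_word_le[OF v(1)] v w(4) show ?thesis by simp
qed

section \<open>Non-commuting reflections have an empty quadrant\<close>

text \<open>Let \<open>K\<close> and \<open>T\<close> act on the integers as two reflections \<open>\<kappa>\<close> and \<open>\<tau>\<close> generating an infinite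
  dihedral group, and let all other walls act trivially. If \<open>K\<close> and \<open>T\<close> do not commute, this
  respects every pair of commuting walls, so each element of \<open>G\<close> obtains an invariant. A path without
  repeated walls contributes at most one \<open>\<kappa>\<close> and one \<open>\<tau>\<close>, so the invariants of two elements
  always differ by one of \<open>1, \<kappa>, \<tau>, \<kappa>\<tau>, \<tau>\<kappa>\<close>. The points \<open>b\<close>, \<open>c\<close>, \<open>e\<close> have invariants \<open>\<tau>\<close>, \<open>\<kappa>\<close>
  and \<open>\<kappa>\<tau>\<close> or \<open>\<tau>\<kappa>\<close>; but \<open>\<kappa>\<tau>\<close> differs from \<open>\<tau>\<close> by \<open>\<tau>\<kappa>\<tau>\<close>, and \<open>\<tau>\<kappa>\<close> differs from \<open>\<kappa>\<close> by \<open>\<kappa>\<tau>\<kappa>\<close>.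
  The fourth quadrant contains \<open>1\<close>.\<close>

lemma noncommuting_empty_quadrant:
  assumes K: "K \<in> carrier G" and T: "T \<in> carrier G"
    and b: "b \<in> carrier G" "K \<notin> separating b" "T \<in> separating b"
    and c: "c \<in> carrier G" "K \<in> separating c" "T \<notin> separating c"
    and e: "e \<in> carrier G" "K \<in> separating e" "T \<in> separating e"
  shows "K \<otimes> T = T \<otimes> K"
proof (rule ccontr)
  assume nc: "K \<otimes> T \<noteq> T \<otimes> K"
  then have KT: "K \<noteq> T" by auto
  \<comment> \<open>the reflections in \<open>0\<close> and \<open>2\<close>; the images of \<open>1\<close> tell the short products apart\<close>
  define \<kappa> \<tau> :: "int \<Rightarrow> int" where "\<kappa> = uminus" and "\<tau> = (-) 4"
  define f where "f = (\<lambda>t. if t = K then \<kappa> else if t = T then \<tau> else id)"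
  have f: "f t \<circ> f t = id" "t \<otimes> t' = t' \<otimes> t \<Longrightarrow> f t \<circ> f t' = f t' \<circ> f t" for t t'
    using nc by (auto simp: f_def \<kappa>_def \<tau>_def fun_eq_iff)
  have distinct: "compose_along f ts \<in>
    (if K \<in> set ts then if T \<in> set ts then {\<kappa> \<circ> \<tau>, \<tau> \<circ> \<kappa>} else {\<kappa>}
     else if T \<in> set ts then {\<tau>} else {id})" if "distinct ts" for ts
    unfolding f_def using that KT by (rule compose_along_two_involutions)
  obtain wb where wb: "wb \<in> lists S" "word_value G wb = b" "distinct (walls wb)"
    "set (walls wb) = separating b" by (rule reduced_word[OF b(1)])
  obtain wc where wc: "wc \<in> lists S" "word_value G wc = c" "distinct (walls wc)"
    "set (walls wc) = separating c" by (rule reduced_word[OF c(1)])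
  obtain we where we: "we \<in> lists S" "word_value G we = e" "distinct (walls we)"
    "set (walls we) = separating e" by (rule reduced_word[OF e(1)])
  \<comment> \<open>compare a shortest path to \<open>e\<close> with a path through \<open>x\<close> that is shortest from \<open>x\<close> on\<close>
  have path: "compose_along f (walls we) \<in>
    (\<lambda>h. compose_along f (walls u) \<circ> h) ` {id, \<kappa>, \<tau>, \<kappa> \<circ> \<tau>, \<tau> \<circ> \<kappa>}"
    if u: "u \<in> lists S" "word_value G u = x" "x \<in> carrier G" for u x
  proof -
    obtain v where v: "v \<in> lists S" "word_value G v = inv x \<otimes> e" "distinct (walls v)"
      by (rule reduced_word[of "inv x \<otimes> e"]) (use u e in auto)
    have "word_value G (u @ v) = e" using u v e by (simp flip: m_assoc)
    then have "compose_along f (walls we) = compose_along f (walls (u @ v))"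
      using u v we f by (intro compose_along_walls_invariant) auto
    also have "walls (u @ v) = walls u @ map (conjugate x) (walls v)"
      using u v by (subst walls_append) auto
    finally have eq: "compose_along f (walls we) =
      compose_along f (walls u) \<circ> compose_along f (map (conjugate x) (walls v))"
      by (simp only: compose_along_append)
    have "distinct (map (conjugate x) (walls v))"
      using v u walls_closed[of v] conjugate_inj[of x] inj_on_subset[of "conjugate x" "carrier G"]
      by (auto simp: distinct_map)
    from distinct[OF this]
    have "compose_along f (map (conjugate x) (walls v)) \<in> {id, \<kappa>, \<tau>, \<kappa> \<circ> \<tau>, \<tau> \<circ> \<kappa>}"
      by (auto split: if_splits)
    with eq show ?thesis by blast
  qed
  have fb: "compose_along f (walls wb) = \<tau>" using distinct[of "walls wb"] wb b by auto
  have fc: "compose_along f (walls wc) = \<kappa>" using distinct[of "walls wc"] wc c by auto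
  have fe: "compose_along f (walls we) \<in> {\<kappa> \<circ> \<tau>, \<tau> \<circ> \<kappa>}" using distinct[of "walls we"] we e by auto
  have "\<exists>h\<in>{id, \<kappa>, \<tau>, \<kappa> \<circ> \<tau>, \<tau> \<circ> \<kappa>}. compose_along f (walls we) 1 = \<tau> (h 1)"
    using path[of wb b] wb b fb by fastforce
  moreover have "\<exists>h\<in>{id, \<kappa>, \<tau>, \<kappa> \<circ> \<tau>, \<tau> \<circ> \<kappa>}. compose_along f (walls we) 1 = \<kappa> (h 1)"
    using path[of wc c] wc c fc by fastforce
  moreover have "compose_along f (walls we) 1 \<in> {-3, 5}"
    using fe by (auto simp: \<kappa>_def \<tau>_def)
  ultimately show False by (auto simp: \<kappa>_def \<tau>_def)
qed

section \<open>Reflections\<close>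

definition reflections :: "'a set" where
  "reflections = {conjugate g s | g s. g \<in> carrier G \<and> s \<in> S}"

lemma reflectionE:
  assumes "r \<in> reflections"
  obtains g s where "g \<in> carrier G" "s \<in> S" "r = conjugate g s"
  using assms unfolding reflections_def by blast

lemma reflection_closed [simp]: "r \<in> reflections \<Longrightarrow> r \<in> carrier G"
  by (auto elim: reflectionE)

lemma gen_reflection [simp]: "s \<in> S \<Longrightarrow> s \<in> reflections"
  unfolding reflections_def using conjugate_one[of s] by force

lemma conjugate_reflection [simp]: "x \<in> carrier G \<Longrightarrow> r \<in> reflections \<Longrightarrow> conjugate x r \<in> reflections"
  unfolding reflections_def using conjugate_conjugate by fastforce

lemma reflection_square:
  assumes "r \<in> reflections"
  shows "r \<otimes> r = \<one>"
proof -
  obtain g s where g: "g \<in> carrier G" "s \<in> S" "r = conjugate g s" using assms by (rule reflectionE)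
  then have "r \<otimes> r = conjugate g \<one>" by (simp add: gens_square flip: conjugate_mult)
  then show ?thesis using g by (simp add: conjugate_def)
qed

lemma reflection_inv [simp]: "r \<in> reflections \<Longrightarrow> inv r = r"
  by (simp add: inv_equality reflection_square)

lemma reflection_cancel [simp]:
  "r \<in> reflections \<Longrightarrow> x \<in> carrier G \<Longrightarrow> r \<otimes> (r \<otimes> x) = x"
  by (simp add: reflection_square flip: m_assoc)

lemma separating_reflections:
  assumes "g \<in> carrier G"
  shows "separating g \<subseteq> reflections"
proof -
  have "set (walls w) \<subseteq> reflections" if "w \<in> lists S" for w
    using that by (induction w) auto
  moreover obtain w where "w \<in> lists S" "set (walls w) = separating g"
    by (rule reduced_word[OF assms])
  ultimately show ?thesis by metis
qed

lemma mem_separating_mult: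
  assumes "x \<in> carrier G" "y \<in> carrier G" "t \<in> carrier G"
  shows "t \<in> separating (x \<otimes> y) \<longleftrightarrow> (t \<in> separating x) \<noteq> (conjugate (inv x) t \<in> separating y)"
  using conjugate_mem_separating_mult[of x y "conjugate (inv x) t"] assms by simp

text \<open>A reflection interchanges the two sides of its own wall and preserves the sides of the wall of any
  other reflection that commutes with it. Both claims are tested on an edge from \<open>g\<close> to \<open>g s\<close> that
  \<open>r\<close> inverts: the only wall it crosses is that of \<open>r\<close>.\<close>

lemma mem_separating_reflection_mult:
  assumes r: "r \<in> reflections" and x: "x \<in> carrier G" and t: "t \<in> reflections" "r \<otimes> t = t \<otimes> r"
  shows "t \<in> separating (r \<otimes> x) \<longleftrightarrow> (t = r) \<noteq> (t \<in> separating x)"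
proof -
  obtain g s where g: "g \<in> carrier G" "s \<in> S" "r = conjugate g s" using r by (rule reflectionE)
  have *: "t \<in> separating (r \<otimes> y) \<longleftrightarrow> (t \<in> separating r) \<noteq> (t \<in> separating y)"
    if "y \<in> carrier G" for y
    using mem_separating_mult[of r y t] r t that conjugate_eq_self_iff[of r t] by simp
  have "r \<otimes> g = g \<otimes> s" using g conjugate_times by simp
  moreover have "t \<in> separating (g \<otimes> s) \<longleftrightarrow> (t \<in> separating g) \<noteq> (t = r)"
    using mem_separating_mult[of g s t] g t by auto
  ultimately have "t \<in> separating r \<longleftrightarrow> t = r" using *[of g] g by auto
  with *[OF x] show ?thesis by simp
qed

lemma reflection_separates_itself: "r \<in> reflections \<Longrightarrow> r \<in> separating r"
  using mem_separating_reflection_mult[of r \<one> r] by simp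

section \<open>Commuting involutions in dimension two\<close>

lemma gen_descent_exists:
  assumes "x \<in> carrier G" "x \<noteq> \<one>"
  shows "\<exists>s\<in>S. s \<in> separating x"
proof -
  obtain w where w: "w \<in> lists S" "word_value G w = x" "set (walls w) = separating x"
    by (rule reduced_word[OF assms(1)])
  with assms obtain s v where "w = s # v" by (cases w) auto
  with w show ?thesis by auto
qed

text \<open>For \<open>s \<noteq> t\<close>, the elements \<open>1\<close>, \<open>s\<close>, \<open>t\<close>, \<open>x\<close> lie in the four different quadrants of the walls of
  \<open>s\<close> and \<open>t\<close>.\<close>

lemma gen_descents_commute:
  assumes "x \<in> carrier G" "s \<in> S" "t \<in> S" "s \<in> separating x" "t \<in> separating x"
  shows "s \<otimes> t = t \<otimes> s"
  using assms noncommuting_empty_quadrant[of s t t s x] by (cases "s = t") auto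

text \<open>When \<open>s\<close> commutes with \<open>x\<close>, stripping the initial letter \<open>s\<close> from \<open>x\<close> is also stripping a final one,
  so no new initial letters appear.\<close>

lemma gen_descent_of_commuting:
  assumes "x \<in> carrier G" "s \<in> S" "s \<in> separating x" "s \<otimes> x = x \<otimes> s"
    "u \<in> S" "u \<in> separating (s \<otimes> x)"
  shows "u \<noteq> s" "u \<in> separating x"
proof -
  show us: "u \<noteq> s" using assms mem_separating_reflection_mult[of s x s] by auto
  define y where "y = s \<otimes> x"
  have ss: "s \<otimes> (s \<otimes> x) = x" using assms(1,2) by simp
  have y: "y \<in> carrier G" using assms(1,2) by (simp add: y_def)
  have "y \<otimes> s = s \<otimes> (x \<otimes> s)" using assms(1,2) by (simp add: y_def m_assoc)
  then have y: "y \<in> carrier G" "y \<otimes> s = x" "y \<otimes> s = s \<otimes> y"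
    using y ss unfolding assms(4)[symmetric] by (simp_all add: y_def)
  have "conjugate (inv y) u \<noteq> s"
  proof
    assume "conjugate (inv y) u = s"
    then have "u = conjugate y s" using y assms by (metis conjugate_inv_conjugate(2) gen_closed)
    then show False using us y assms conjugate_eq_self_iff[of y s] by simp
  qed
  then show "u \<in> separating x"
    using mem_separating_mult[of y s u] y assms by (simp add: y_def)
qed

text \<open>Triangle-freeness of the defining graph, expressed in the group.\<close>

definition no_commuting_triple :: bool where
  "no_commuting_triple \<longleftrightarrow> \<not> (\<exists>s\<in>S. \<exists>t\<in>S. \<exists>u\<in>S. s \<noteq> t \<and> s \<noteq> u \<and> t \<noteq> u \<and>
    s \<otimes> t = t \<otimes> s \<and> s \<otimes> u = u \<otimes> s \<and> t \<otimes> u = u \<otimes> t)"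

text \<open>An involution begins and ends with the same letters. If such a letter \<open>s\<close> did not commute with \<open>x\<close>,
  conjugating by it would remove it at both ends and shorten \<open>x\<close>.\<close>

lemma involution_shortest_conjugate:
  assumes x: "x \<in> carrier G" "x \<otimes> x = \<one>"
    and shortest: "\<And>g. g \<in> carrier G \<Longrightarrow> card (separating x) \<le> card (separating (conjugate g x))"
    and s: "s \<in> S" "s \<in> separating x"
  shows "s \<otimes> x = x \<otimes> s"
proof -
  define y r r' where "y = s \<otimes> x" and "r = conjugate x s" and "r' = conjugate s r"
  have c: "y \<in> carrier G" "r \<in> carrier G" "r' \<in> carrier G" using x s by (auto simp: y_def r_def r'_def)
  have "card (separating y) < card (separating x)"
    unfolding y_def using x s by (intro strong_exchange)
  also have "\<dots> \<le> card (separating (y \<otimes> s))"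
    using shortest[of s] s by (simp add: y_def conjugate_def)
  also have "y \<otimes> s = r' \<otimes> y"
    using x s conjugate_times[of y s] by (simp add: r'_def r_def y_def conjugate_conjugate)
  finally have "r' \<notin> separating y" using strong_exchange[of y r'] c by auto
  moreover have "r \<in> separating x"
    using conjugate_mem_separating_mult[of x x s] x s by (simp add: r_def)
  ultimately have "r' = s"
    using conjugate_mem_separating_mult[of s x r] x s c by (simp add: r'_def y_def)
  moreover have "conjugate s s = s" using s conjugate_eq_self_iff[of s s] by simp
  ultimately have "r = s"
    using c s inj_onD[OF conjugate_inj[of s], of r s] by (simp add: r'_def)
  then show ?thesis using conjugate_eq_self_iff[of x s] x s by (simp add: r_def)
qed

text \<open>After conjugation to shortest length, the involution commutes with its initial letters. By
  \<open>gen_descent_of_commuting\<close> it is then the product of these letters, which commute with each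
  other, so there are at most two.\<close>

lemma involution_conjugate:
  assumes "no_commuting_triple" and x: "x \<in> carrier G" "x \<otimes> x = \<one>" "x \<noteq> \<one>"
  obtains g s where "g \<in> carrier G" "s \<in> S" "x = conjugate g s"
  | g s t where "g \<in> carrier G" "s \<in> S" "t \<in> S" "s \<noteq> t" "s \<otimes> t = t \<otimes> s" "x = conjugate g (s \<otimes> t)"
proof -
  have "\<one> \<in> carrier G" by simp
  from ex_has_least_nat[where P = "\<lambda>g. g \<in> carrier G" and m = "\<lambda>g. card (separating (conjugate g x))", OF this]
  obtain g where g: "g \<in> carrier G"
    "\<And>h. h \<in> carrier G \<Longrightarrow> card (separating (conjugate g x)) \<le> card (separating (conjugate h x))" by blast
  define y where "y = conjugate g x"
  have xy: "x = conjugate (inv g) y" using x g by (simp add: y_def)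
  have one: "conjugate h \<one> = \<one>" if "h \<in> carrier G" for h using that by (simp add: conjugate_def)
  have "y \<otimes> y = conjugate g (x \<otimes> x)" using x(1) g(1) by (simp add: y_def conjugate_mult)
  moreover have "y \<noteq> \<one>"
  proof
    assume "y = \<one>"
    then have "x = \<one>" using xy one[of "inv g"] g(1) by simp
    then show False using x(3) by simp
  qed
  ultimately have y: "y \<in> carrier G" "y \<otimes> y = \<one>" "y \<noteq> \<one>"
    using x(1,2) g(1) one[of g] by (simp_all add: y_def)
  have commute: "s \<otimes> y = y \<otimes> s" if "s \<in> S" "s \<in> separating y" for s
    using y(1,2) _ that
  proof (rule involution_shortest_conjugate)
    fix h assume "h \<in> carrier G"
    then show "card (separating y) \<le> card (separating (conjugate h y))"
      using g(2)[of "h \<otimes> g"] g x by (simp add: y_def conjugate_conjugate)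
  qed
  obtain s where s: "s \<in> S" "s \<in> separating y" using gen_descent_exists y by blast
  have sy: "s \<otimes> y = y \<otimes> s" using commute s by blast
  show thesis
  proof (cases "s \<otimes> y = \<one>")
    case True
    then have "y = s" using s(1) y(1) reflection_cancel[of s y] by simp
    with that(1)[of "inv g" s] xy g(1) s(1) show thesis by simp
  next
    case False
    then obtain t where t: "t \<in> S" "t \<in> separating (s \<otimes> y)"
      using gen_descent_exists[of "s \<otimes> y"] s y by auto
    have t': "t \<noteq> s" "t \<in> separating y"
      using gen_descent_of_commuting[of y s t] y s t sy by auto
    have st: "s \<otimes> t = t \<otimes> s" using gen_descents_commute[of y s t] y s t t' by simp
    have ty: "t \<otimes> y = y \<otimes> t" using commute t t' by blast
    have "t \<otimes> (s \<otimes> y) = (t \<otimes> s) \<otimes> y" using t(1) s(1) y(1) by (simp add: m_assoc)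
    also have "\<dots> = s \<otimes> (t \<otimes> y)" using t(1) s(1) y(1) by (simp add: m_assoc flip: st)
    also have "\<dots> = (s \<otimes> y) \<otimes> t" using t(1) s(1) y(1) by (simp add: m_assoc ty)
    finally have tsy: "t \<otimes> (s \<otimes> y) = (s \<otimes> y) \<otimes> t" .
    have "t \<otimes> (s \<otimes> y) = \<one>"
    proof (rule ccontr)
      assume "t \<otimes> (s \<otimes> y) \<noteq> \<one>"
      then obtain u where u: "u \<in> S" "u \<in> separating (t \<otimes> (s \<otimes> y))"
        using gen_descent_exists[of "t \<otimes> (s \<otimes> y)"] s t y by auto
      have u': "u \<noteq> t" "u \<in> separating (s \<otimes> y)"
        using gen_descent_of_commuting[of "s \<otimes> y" t u] y s t u tsy by auto
      have u'': "u \<noteq> s" "u \<in> separating y"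
        using gen_descent_of_commuting[of y s u] y s u u' sy by auto
      have "s \<otimes> u = u \<otimes> s" "t \<otimes> u = u \<otimes> t"
        using gen_descents_commute[of y] y s t t' u u'' by blast+
      with assms(1) s t t' u u' u'' st show False
        unfolding no_commuting_triple_def by metis
    qed
    then have "s \<otimes> y = t" using s(1) t(1) y(1) reflection_cancel[of t "s \<otimes> y"] by simp
    then have "y = s \<otimes> t" using s(1) y(1) reflection_cancel[of s y] by simp
    with that(2)[of "inv g" s t] xy g(1) s(1) t(1) t'(1) st show thesis by blast
  qed
qed

lemma mem_separating_two_gens:
  assumes "s \<in> S" "t \<in> S" "s \<otimes> t = t \<otimes> s" "v \<in> separating (s \<otimes> t)"
  shows "v = s \<or> v = t"
proof -
  have v: "v \<in> carrier G" using separating_closed[of "s \<otimes> t"] assms by auto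
  have "v = s \<or> conjugate s v = t"
    using mem_separating_mult[of s t v] assms v by auto
  then show ?thesis
    using assms v conjugate_inv_conjugate(1)[of s v] conjugate_eq_self_iff[of s t] by auto
qed

text \<open>Multiplying by \<open>s\<close> and \<open>t\<close> brings \<open>y\<close> to the same side as \<open>1\<close> of both their walls. If the resulting
  element were not \<open>1\<close>, it would have an initial letter \<open>u\<close>. Its product with \<open>s t\<close> would have the
  initial letters \<open>s\<close>, \<open>t\<close> and \<open>u\<close>, which commute with each other, and there are no three such generators.\<close>

lemma centralizer_of_two_gens:
  assumes "no_commuting_triple" and st: "s \<in> S" "t \<in> S" "s \<noteq> t" "s \<otimes> t = t \<otimes> s"
    and y: "y \<in> carrier G" "(s \<otimes> t) \<otimes> y = y \<otimes> (s \<otimes> t)"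
  shows "y \<in> {\<one>, s, t, s \<otimes> t}"
proof -
  have trivial: "y = \<one>"
    if y: "y \<in> carrier G" "(s \<otimes> t) \<otimes> y = y \<otimes> (s \<otimes> t)" and n: "s \<notin> separating y" "t \<notin> separating y" for y
  proof (rule ccontr)
    assume "y \<noteq> \<one>"
    then obtain u where u: "u \<in> S" "u \<in> separating y" using gen_descent_exists y by blast
    have us: "u \<noteq> s" "u \<noteq> t" using u n by auto
    define z where "z = s \<otimes> (t \<otimes> y)"
    have z: "z \<in> carrier G" "z = y \<otimes> (s \<otimes> t)"
      using y(1) st(1,2) by (simp_all add: z_def m_assoc flip: y(2))
    have sz: "s \<in> separating z" "t \<in> separating z"
      using mem_separating_reflection_mult[of s "t \<otimes> y" s]
        mem_separating_reflection_mult[of s "t \<otimes> y" t]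
        mem_separating_reflection_mult[of t y s] mem_separating_reflection_mult[of t y t] st y n
      by (auto simp: z_def)
    have image: "v = conjugate y s \<or> v = conjugate y t"
      if "v \<in> carrier G" "conjugate (inv y) v \<in> separating (s \<otimes> t)" for v
    proof -
      have "v = conjugate y (conjugate (inv y) v)" using that y by simp
      then show ?thesis using mem_separating_two_gens[OF st(1,2,4) that(2)] by auto
    qed
    \<comment> \<open>so \<open>y\<close> permutes \<open>s\<close> and \<open>t\<close> by conjugation\<close>
    have "s = conjugate y s \<or> s = conjugate y t" "t = conjugate y s \<or> t = conjugate y t"
      using sz n y st mem_separating_mult[of y "s \<otimes> t"] image unfolding z(2) by auto
    then have "{conjugate y s, conjugate y t} = {s, t}" using st(3) by auto
    then have "conjugate (inv y) u \<notin> separating (s \<otimes> t)" using image[of u] u us by auto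
    then have "u \<in> separating z"
      using mem_separating_mult[of y "s \<otimes> t" u] y st u unfolding z(2) by simp
    then have "s \<otimes> u = u \<otimes> s" "t \<otimes> u = u \<otimes> t"
      using gen_descents_commute[of z] z u sz st by blast+
    with assms(1) st u us show False unfolding no_commuting_triple_def by metis
  qed
  have s': "s \<otimes> (s \<otimes> t) = (s \<otimes> t) \<otimes> s" "t \<otimes> (s \<otimes> t) = (s \<otimes> t) \<otimes> t"
    using st by (metis gen_closed m_assoc)+
  have move: "(s \<otimes> t) \<otimes> (a \<otimes> z) = (a \<otimes> z) \<otimes> (s \<otimes> t)"
    if "a \<in> {s, t}" "z \<in> carrier G" "(s \<otimes> t) \<otimes> z = z \<otimes> (s \<otimes> t)" for a z
  proof -
    have a: "a \<in> carrier G" "a \<otimes> (s \<otimes> t) = (s \<otimes> t) \<otimes> a" using that s' st by auto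
    have "(s \<otimes> t) \<otimes> (a \<otimes> z) = ((s \<otimes> t) \<otimes> a) \<otimes> z" using a(1) that(2) st(1,2) by (simp add: m_assoc)
    also have "\<dots> = a \<otimes> ((s \<otimes> t) \<otimes> z)" using a(1) that(2) st(1,2) by (simp add: m_assoc flip: a(2))
    also have "\<dots> = a \<otimes> (z \<otimes> (s \<otimes> t))" using that(3) by simp
    also have "\<dots> = (a \<otimes> z) \<otimes> (s \<otimes> t)" using a(1) that(2) st(1,2) by (simp add: m_assoc)
    finally show ?thesis .
  qed
  have sep: "s \<in> separating (s \<otimes> z) \<longleftrightarrow> s \<notin> separating z" "t \<in> separating (s \<otimes> z) \<longleftrightarrow> t \<in> separating z"
    "t \<in> separating (t \<otimes> z) \<longleftrightarrow> t \<notin> separating z" "s \<in> separating (t \<otimes> z) \<longleftrightarrow> s \<in> separating z"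
    if "z \<in> carrier G" for z
    using that st by (auto simp: mem_separating_reflection_mult)
  have ty: "t \<otimes> y \<in> carrier G" "(s \<otimes> t) \<otimes> (t \<otimes> y) = (t \<otimes> y) \<otimes> (s \<otimes> t)" using move[of t y] y st by auto
  consider "y = \<one>" | "s \<otimes> y = \<one>" | "t \<otimes> y = \<one>" | "s \<otimes> (t \<otimes> y) = \<one>"
    using trivial[of y] trivial[of "s \<otimes> y"] trivial[of "t \<otimes> y"] trivial[of "s \<otimes> (t \<otimes> y)"]
      move[of s y] move[of s "t \<otimes> y"] ty sep[of y] sep[of "t \<otimes> y"] y st
    by (metis gen_closed insertI1 m_closed)
  then show ?thesis
  proof cases
    case 2
    then have "y = s" using st y reflection_cancel[of s y] by simp
    then show ?thesis by simp
  next
    case 3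
    then have "y = t" using st y reflection_cancel[of t y] by simp
    then show ?thesis by simp
  next
    case 4
    then have "t \<otimes> y = s" using st y reflection_cancel[of s "t \<otimes> y"] by simp
    then have "y = t \<otimes> s" using st y reflection_cancel[of t y] by simp
    then show ?thesis using st by simp
  qed simp
qed

text \<open>If \<open>x\<close> is conjugate to \<open>s t\<close>, its centralizer leaves only the conjugates of \<open>s\<close> and \<open>t\<close> for \<open>y\<close>.\<close>

lemma reflection_or_neighbour_reflection:
  assumes "no_commuting_triple"
    and x: "x \<in> carrier G" "x \<otimes> x = \<one>" "x \<noteq> \<one>"
    and y: "y \<in> carrier G" "y \<noteq> \<one>" "x \<noteq> y" "x \<otimes> y = y \<otimes> x"
  shows "x \<in> reflections \<or> y \<in> reflections \<and> x \<otimes> y \<in> reflections"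
  using assms(1) x
proof (cases rule: involution_conjugate)
  case (1 g s)
  then show ?thesis by simp
next
  case (2 g s t)
  define z where "z = conjugate (inv g) y"
  have z: "z \<in> carrier G" "y = conjugate g z" using y 2 by (auto simp: z_def)
  have "conjugate g ((s \<otimes> t) \<otimes> z) = conjugate g (z \<otimes> (s \<otimes> t))" using y(4) 2 z by (simp add: conjugate_mult)
  then have "(s \<otimes> t) \<otimes> z = z \<otimes> (s \<otimes> t)"
    using inj_onD[OF conjugate_inj[of g], of "(s \<otimes> t) \<otimes> z" "z \<otimes> (s \<otimes> t)"] 2 z by simp
  with centralizer_of_two_gens[of s t z] assms(1) 2 z have "z \<in> {\<one>, s, t, s \<otimes> t}" by blast
  moreover have "z \<noteq> \<one>" "z \<noteq> s \<otimes> t" using y z 2 by (auto simp: conjugate_def)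
  ultimately have "z = s \<or> z = t" by blast
  then show ?thesis
  proof
    assume "z = s"
    then have "x \<otimes> y = conjugate g (t \<otimes> (s \<otimes> s))" using 2 z by (simp add: m_assoc flip: conjugate_mult)
    then show ?thesis using \<open>z = s\<close> 2 z by (simp add: gens_square)
  next
    assume "z = t"
    then have "x \<otimes> y = conjugate g (s \<otimes> (t \<otimes> t))" using 2(1-3,6) z by (simp add: m_assoc flip: conjugate_mult)
    then show ?thesis using \<open>z = t\<close> 2 z by (simp add: gens_square)
  qed
qed

section \<open>Generating reflections that face each other\<close>

text \<open>The distance from \<open>1\<close> to the nearest edge inverted by \<open>r\<close>.\<close>

definition depth :: "'a \<Rightarrow> nat" where
  "depth r = (LEAST n. \<exists>g\<in>carrier G. \<exists>s\<in>S. r = conjugate g s \<and> card (separating g) = n)"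

lemma depth_le: "g \<in> carrier G \<Longrightarrow> s \<in> S \<Longrightarrow> depth (conjugate g s) \<le> card (separating g)"
  unfolding depth_def by (rule Least_le) blast

text \<open>The wall of \<open>r'\<close> lies behind that of \<open>r\<close>. A shortest path from \<open>1\<close> to the wall of \<open>r'\<close> therefore
  crosses that of \<open>r\<close>, and folding it along the wall of \<open>r\<close> gives a shorter path to the wall of \<open>r r' r\<close>.\<close>

lemma depth_decreases:
  assumes r: "r \<in> reflections" "r' \<in> reflections" "r \<noteq> r'"
    and nested: "\<And>w. w \<in> carrier G \<Longrightarrow> r' \<in> separating w \<Longrightarrow> r \<in> separating w"
  shows "depth (conjugate r r') < depth r'"
proof -
  have "\<exists>n. \<exists>g\<in>carrier G. \<exists>s\<in>S. r' = conjugate g s \<and> card (separating g) = n"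
    using reflectionE[OF r(2)] by blast
  from LeastI_ex[OF this] obtain g s where g: "g \<in> carrier G" "s \<in> S" "r' = conjugate g s"
    "card (separating g) = depth r'" unfolding depth_def by blast
  have r'g: "r' \<otimes> g = g \<otimes> s" using g(1-3) conjugate_times by simp
  have "conjugate s s = s" using g conjugate_eq_self_iff[of s s] by simp
  then have "r' = conjugate (g \<otimes> s) s" using g by (simp flip: conjugate_conjugate)
  then have "depth r' \<le> card (separating (g \<otimes> s))" using depth_le[of "g \<otimes> s" s] g(1,2) by simp
  then have "r' \<notin> separating g" using strong_exchange[of g r'] r'g g by auto
  then have "r' \<in> separating (g \<otimes> s)" using mem_separating_mult[of g s r'] g by simp
  then have "r \<in> separating (g \<otimes> s)" using nested g by simp
  moreover have "conjugate (inv g) r \<noteq> s" using r g by (metis conjugate_inv_conjugate(2) reflection_closed)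
  ultimately have "r \<in> separating g" using mem_separating_mult[of g s r] g r by simp
  then have "card (separating (r \<otimes> g)) < depth r'" using strong_exchange[of g r] g by simp
  moreover have "conjugate r r' = conjugate (r \<otimes> g) s" using g r by (simp add: conjugate_conjugate)
  ultimately show ?thesis using depth_le[of "r \<otimes> g" s] g r by simp
qed

text \<open>The half-space of \<open>r\<close> not containing \<open>1\<close> is the set of \<open>w\<close> with \<open>r \<in> separating w\<close>. A facing set
  satisfies the hypothesis of a ping-pong argument.\<close>

definition facing :: "'a set \<Rightarrow> bool" where
  "facing R \<longleftrightarrow> (\<forall>r\<in>R. \<forall>r'\<in>R. r \<otimes> r' = r' \<otimes> r \<or>
    (\<forall>w\<in>carrier G. \<not> (r \<in> separating w \<and> r' \<in> separating w)))"

lemma generate_reflected_reflection: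
  assumes R: "R \<subseteq> reflections" and r: "r \<in> R" "r' \<in> R" "r \<noteq> r'"
  shows "generate G (insert (conjugate r r') (R - {r'})) = generate G R" (is "generate G ?R = _")
proof -
  have carrier: "R \<subseteq> carrier G" using R by auto
  moreover have "conjugate r r' \<in> carrier G" using carrier r by (intro conjugate_closed) auto
  ultimately have carrier: "R \<subseteq> carrier G" "?R \<subseteq> carrier G" by auto
  have conj: "conjugate x y \<in> generate G A" if "x \<in> generate G A" "y \<in> generate G A" "A \<subseteq> carrier G" for x y A
    unfolding conjugate_def using that by (intro generate.eng generate_m_inv_closed)
  have "conjugate r r' \<in> generate G R" using conj[of r R r'] carrier r by (simp add: generate.incl)
  then have "generate G ?R \<subseteq> generate G R"
    using carrier by (intro generate_subgroup_incl generate_is_subgroup) (auto intro: generate.incl)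
  moreover have "r \<otimes> r = \<one>" using R r by (auto intro: reflection_square)
  then have "conjugate r (conjugate r r') = r'" using R r by (subst conjugate_conjugate) auto
  then have "r' \<in> generate G ?R"
    using conj[of r ?R "conjugate r r'"] carrier r by (simp add: generate.incl)
  then have "generate G R \<subseteq> generate G ?R"
    using carrier by (intro generate_subgroup_incl generate_is_subgroup) (auto intro: generate.incl)
  ultimately show ?thesis by blast
qed

text \<open>If two non-commuting generators have half-spaces (not containing \<open>1\<close>) that meet, one of these is
  contained in the other by \<open>noncommuting_empty_quadrant\<close>; reflecting the deeper wall in the other one
  lowers the total depth without changing the generated subgroup.\<close>

lemma facing_generators_exist:
  assumes "finite R" "R \<subseteq> reflections"
  shows "\<exists>R'. finite R' \<and> R' \<subseteq> reflections \<and> generate G R' = generate G R \<and> facing R'"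
  using assms
proof (induction "sum depth R" arbitrary: R rule: less_induct)
  case less
  show ?case
  proof (cases "facing R")
    case False
    then obtain r r' w where r: "r \<in> R" "r' \<in> R" "r \<otimes> r' \<noteq> r' \<otimes> r"
      "w \<in> carrier G" "r \<in> separating w" "r' \<in> separating w" unfolding facing_def by blast
    have "\<exists>a\<in>R. \<exists>b\<in>R. a \<noteq> b \<and> (\<forall>w\<in>carrier G. b \<in> separating w \<longrightarrow> a \<in> separating w)"
    proof (rule ccontr)
      assume *: "\<not> ?thesis"
      have "r \<noteq> r'" using r by auto
      with * r obtain b c where "b \<in> carrier G" "r \<notin> separating b" "r' \<in> separating b"
        "c \<in> carrier G" "r \<in> separating c" "r' \<notin> separating c" by metis
      then show False
        using noncommuting_empty_quadrant[of r r' b c w] r less.prems(2) reflection_closed by blast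
    qed
    then obtain a b where ab: "a \<in> R" "b \<in> R" "a \<noteq> b"
      "\<And>w. w \<in> carrier G \<Longrightarrow> b \<in> separating w \<Longrightarrow> a \<in> separating w" by blast
    let ?R = "insert (conjugate a b) (R - {b})"
    have "sum depth ?R \<le> depth (conjugate a b) + sum depth (R - {b})"
      using less.prems by (cases "conjugate a b \<in> R - {b}") (auto simp: insert_absorb)
    also have "\<dots> < depth b + sum depth (R - {b})"
      using depth_decreases[of a b] ab less.prems by auto
    also have "\<dots> = sum depth R" using sum.remove[of R b depth] less.prems ab by simp
    finally have "sum depth ?R < sum depth R" .
    moreover have "a \<in> reflections" "b \<in> reflections" using less.prems ab by auto
    then have "finite ?R" "?R \<subseteq> reflections" using less.prems by auto
    ultimately have "\<exists>R'. finite R' \<and> R' \<subseteq> reflections \<and> generate G R' = generate G ?R \<and> facing R'"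
      by (rule less.hyps)
    then show ?thesis using generate_reflected_reflection[of R a b] less.prems ab by simp
  qed (use less.prems in blast)
qed

lemma generate_reflections_word:
  assumes "R \<subseteq> reflections" "h \<in> generate G R"
  shows "\<exists>w\<in>lists R. word_value G w = h"
  using assms(2)
proof induction
  case one
  show ?case by (rule bexI[of _ "[]"]) auto
next
  case (incl h)
  then show ?case using assms(1) by (intro bexI[of _ "[h]"]) auto
next
  case (inv h)
  then show ?case using assms(1) by (intro bexI[of _ "[h]"]) auto
next
  case (eng h1 h2)
  then obtain u v where uv: "u \<in> lists R" "v \<in> lists R" "word_value G u = h1" "word_value G v = h2"
    by blast
  have "lists R \<subseteq> lists (carrier G)" using assms(1) by (intro lists_mono) auto
  then have "word_value G (u @ v) = h1 \<otimes> h2" using uv by (subst word_value_append) auto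
  then show ?case using uv by (intro bexI[of _ "u @ v"]) auto
qed

text \<open>Words over \<open>R\<close> of least length among the words over \<open>R\<close> with the same value; this is not length with
  respect to the generators \<open>S\<close>.\<close>

definition shortest_in :: "'a set \<Rightarrow> 'a list \<Rightarrow> bool" where
  "shortest_in R w \<longleftrightarrow> w \<in> lists R \<and>
    (\<forall>v\<in>lists R. word_value G v = word_value G w \<longrightarrow> length w \<le> length v)"

lemma shortest_in_Cons:
  assumes "shortest_in R (r # w)"
  shows "r \<in> R" "w \<in> lists R" "shortest_in R w"
proof -
  show r: "r \<in> R" and "w \<in> lists R" using assms by (auto simp: shortest_in_def)
  moreover have "length w \<le> length v" if "v \<in> lists R" "word_value G v = word_value G w" for v
    using assms that r by (auto simp: shortest_in_def dest!: bspec[of _ _ "r # v"])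
  ultimately show "shortest_in R w" by (simp add: shortest_in_def)
qed

text \<open>This is ping-pong. Suppose that the value of a shortest word \<open>r q w\<close> lay on the same side of \<open>r\<close> as \<open>1\<close>. Then the
  value of \<open>q w\<close> lies beyond both \<open>r\<close> and \<open>q\<close>, so these commute. Hence \<open>r w\<close> is a shortest word as well, and
  the induction hypothesis for it contradicts that for \<open>q w\<close>.\<close>

lemma shortest_in_separates_head:
  assumes R: "R \<subseteq> reflections" "facing R" and "shortest_in R (r # w)"
  shows "r \<in> separating (word_value G (r # w))"
  using assms(3)
proof (induction w arbitrary: r rule: list.induct)
  case Nil
  then have "r \<in> reflections" using R shortest_in_Cons by blast
  then show ?case using reflection_separates_itself by simp
next
  case (Cons q w)
  note rqw = shortest_in_Cons[OF Cons.prems]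
  note qw = shortest_in_Cons[OF rqw(3)]
  define x where "x = word_value G w"
  have "lists R \<subseteq> lists (carrier G)" using R by (intro lists_mono) auto
  then have "w \<in> lists (carrier G)" using qw by blast
  then have x: "x \<in> carrier G" by (simp add: x_def)
  have rq: "r \<in> reflections" "q \<in> reflections" using R rqw qw by auto
  have short: "length w + 2 \<le> length v"
    if "v \<in> lists R" "word_value G v = r \<otimes> (q \<otimes> x)" for v
    using Cons.prems that by (simp add: shortest_in_def x_def)
  have "r \<noteq> q" using short[of w] qw x rq by (auto simp: x_def)
  show ?case
  proof (rule ccontr)
    assume "\<not> ?thesis"
    then have "r \<in> separating (q \<otimes> x)"
      using mem_separating_reflection_mult[of r "q \<otimes> x" r] rq x by (simp add: x_def)
    moreover have "q \<in> separating (q \<otimes> x)" using Cons.IH[OF rqw(3)] by (simp add: x_def)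
    ultimately have comm: "r \<otimes> q = q \<otimes> r"
      using R(2) rqw(1) qw(1) rq x unfolding facing_def by (meson m_closed reflection_closed)
    have "r \<in> separating x"
      using mem_separating_reflection_mult[of q x r] rq x comm \<open>r \<noteq> q\<close> \<open>r \<in> separating (q \<otimes> x)\<close> by simp
    have "shortest_in R (r # w)"
      unfolding shortest_in_def
    proof (intro conjI ballI impI)
      show "r # w \<in> lists R" using rqw qw by simp
      fix v assume v: "v \<in> lists R" "word_value G v = word_value G (r # w)"
      have "word_value G (q # v) = (q \<otimes> r) \<otimes> x" using v rq x by (simp add: x_def m_assoc)
      also have "\<dots> = r \<otimes> (q \<otimes> x)" using rq x by (simp add: m_assoc flip: comm)
      finally show "length (r # w) \<le> length v" using short[of "q # v"] v qw by simp
    qed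
    then have "r \<in> separating (r \<otimes> x)" using Cons.IH by (simp add: x_def)
    then show False
      using mem_separating_reflection_mult[of r x r] rq x \<open>r \<in> separating x\<close> by simp
  qed
qed

section \<open>Geodesics between elements of a reflection subgroup\<close>

text \<open>Write \<open>h\<close> as a shortest word over \<open>R\<close> with first letter \<open>r\<close>. If \<open>r\<close> commutes with \<open>K\<close>, it preserves the
  sides of the wall of \<open>K\<close> and can be stripped from \<open>h\<close>. Otherwise some quadrant of \<open>K\<close> and \<open>r\<close> is empty; as \<open>1\<close>,
  \<open>d\<close> and \<open>h\<close> occupy three of them, \<open>r\<close> cannot lie in the fourth, so \<open>K\<close> separates \<open>1\<close> from \<open>r\<close>.\<close>

lemma separating_wall_near_generator:
  assumes R: "R \<subseteq> reflections" "facing R"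
    and d: "d \<in> carrier G" "R \<inter> separating d = {}" and h: "h \<in> generate G R"
    and K: "K \<in> separating d" "K \<in> separating h"
  shows "\<exists>r\<in>R. K \<in> separating r"
proof (rule ccontr)
  assume far: "\<not> ?thesis"
  have Kr: "K \<in> reflections" using separating_reflections d K by blast
  have "K \<notin> separating (word_value G w)" if "shortest_in R w" for w
    using that
  proof (induction w rule: list.induct)
    case (Cons r w)
    note rw = shortest_in_Cons[OF Cons.prems]
    define x where "x = word_value G w"
    have "lists R \<subseteq> lists (carrier G)" using R by (intro lists_mono) auto
    then have "w \<in> lists (carrier G)" using rw by blast
    then have x: "x \<in> carrier G" by (simp add: x_def)
    have r: "r \<in> reflections" "K \<noteq> r" using R rw d K by auto
    have rx: "r \<in> separating (r \<otimes> x)"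
      using shortest_in_separates_head[OF R Cons.prems] by (simp add: x_def)
    have "K \<notin> separating x" using Cons.IH rw by (simp add: x_def)
    have "K \<notin> separating (r \<otimes> x)"
    proof
      assume Kx: "K \<in> separating (r \<otimes> x)"
      have "K \<otimes> r = r \<otimes> K"
      proof (rule noncommuting_empty_quadrant[of K r r d "r \<otimes> x"])
        show "K \<notin> separating r" using far rw by blast
        show "r \<notin> separating d" using d rw by blast
      qed (use Kr r d x rx Kx K reflection_separates_itself in simp_all)
      then show False
        using mem_separating_reflection_mult[of r x K] Kr r x Kx \<open>K \<notin> separating x\<close> by simp
    qed
    then show ?case by (simp add: x_def)
  qed simp
  moreover obtain w where "shortest_in R w" "word_value G w = h"
  proof -
    obtain u where "u \<in> lists R \<and> word_value G u = h" using generate_reflections_word[OF R(1) h] by blast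
    from ex_has_least_nat[where P = "\<lambda>u. u \<in> lists R \<and> word_value G u = h" and m = length, OF this]
    obtain w where "w \<in> lists R" "word_value G w = h"
      "\<forall>v. v \<in> lists R \<and> word_value G v = h \<longrightarrow> length w \<le> length v" by blast
    with that show ?thesis unfolding shortest_in_def by blast
  qed
  ultimately show False using K by blast
qed

text \<open>As long as some generating wall separates \<open>1\<close> from \<open>z\<close>, reflecting \<open>z\<close> in it brings \<open>z\<close> closer to \<open>1\<close>.\<close>

lemma reflection_subgroup_fundamental_domain:
  assumes R: "R \<subseteq> reflections" and "z \<in> carrier G"
  shows "\<exists>h\<in>generate G R. \<exists>d\<in>carrier G. z = h \<otimes> d \<and> R \<inter> separating d = {}"
  using assms(2)
proof (induction "card (separating z)" arbitrary: z rule: less_induct)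
  case less
  show ?case
  proof (cases "R \<inter> separating z = {}")
    case True
    then show ?thesis using less.prems generate.one[of G R] by (metis l_one)
  next
    case False
    then obtain r where r: "r \<in> R" "r \<in> separating z" by blast
    have rr: "r \<in> reflections" using R r by blast
    obtain h d where hd: "h \<in> generate G R" "d \<in> carrier G" "r \<otimes> z = h \<otimes> d" "R \<inter> separating d = {}"
      using less.hyps[of "r \<otimes> z"] strong_exchange[of z r] less.prems r rr by auto
    have "R \<subseteq> carrier G" using R by auto
    then have h: "h \<in> carrier G" using generate_in_carrier hd by blast
    have "z = r \<otimes> (h \<otimes> d)" using rr less.prems by (simp flip: hd(3))
    also have "\<dots> = (r \<otimes> h) \<otimes> d" using rr h hd by (simp add: m_assoc)
    finally show ?thesis using hd r generate.eng[OF generate.incl[of r R] hd(1)] by blast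
  qed
qed

text \<open>This is the word metric, see \<open>wall_dist_eq\<close>; in this form it makes the geodesic condition a statement
  about sets of walls.\<close>

definition wall_dist :: "'a \<Rightarrow> 'a \<Rightarrow> nat" where
  "wall_dist x y = card (sym_diff (separating x) (separating y))"

lemma wall_dist_sym: "wall_dist x y = wall_dist y x"
  by (simp add: wall_dist_def Un_commute)

lemma wall_dist_eq:
  assumes "x \<in> carrier G" "y \<in> carrier G"
  shows "wall_dist x y = card (separating (inv x \<otimes> y))"
proof -
  let ?z = "inv x \<otimes> y"
  have z: "?z \<in> carrier G" "x \<otimes> ?z = y" using assms by (simp_all flip: m_assoc)
  have mem: "t \<in> separating y \<longleftrightarrow> (t \<in> separating x) \<noteq> (conjugate (inv x) t \<in> separating ?z)"
    if "t \<in> carrier G" for t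
    using mem_separating_mult[of x ?z t] z assms that by simp
  have "sym_diff (separating x) (separating y) = conjugate x ` separating ?z"
  proof (intro equalityI subsetI)
    fix t assume t: "t \<in> sym_diff (separating x) (separating y)"
    then have "t \<in> carrier G" using separating_closed assms by blast
    with t mem[of t] have "t = conjugate x (conjugate (inv x) t)" "conjugate (inv x) t \<in> separating ?z" using assms by auto
    then show "t \<in> conjugate x ` separating ?z" by blast
  next
    fix t assume "t \<in> conjugate x ` separating ?z"
    then obtain u where u: "t = conjugate x u" "u \<in> separating ?z" by blast
    then have "u \<in> carrier G" using separating_closed[of ?z] z by blast
    with u mem[of t] assms show "t \<in> sym_diff (separating x) (separating y)" by auto
  qed
  moreover have "inj_on (conjugate x) (separating ?z)"
    using conjugate_inj[OF assms(1)] separating_closed[of ?z] z inj_on_subset by blast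
  ultimately show ?thesis by (simp add: wall_dist_def card_image)
qed

text \<open>Lying on a geodesic means that no wall separates \<open>z\<close> from both \<open>x\<close> and \<open>y\<close>. Write \<open>z = h d\<close> as above. After
  translation by \<open>h\<inverse>\<close>, every wall between \<open>1\<close> and \<open>d\<close> separates \<open>1\<close> from \<open>h\<inverse> x\<close> or from \<open>h\<inverse> y\<close>, both of which
  lie in the subgroup.\<close>

lemma reflection_subgroup_near_geodesics:
  assumes R: "finite R" "R \<subseteq> reflections" "facing R"
    and xy: "x \<in> generate G R" "y \<in> generate G R" and z: "z \<in> carrier G"
    and between: "wall_dist x z + wall_dist z y \<le> wall_dist x y"
  shows "\<exists>h\<in>generate G R. wall_dist z h \<le> (\<Sum>r\<in>R. card (separating r))"
proof -
  have RG: "R \<subseteq> carrier G" using R by auto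
  then have c: "x \<in> carrier G" "y \<in> carrier G" using generate_in_carrier xy by blast+
  obtain h d where hd: "h \<in> generate G R" "d \<in> carrier G" "z = h \<otimes> d" "R \<inter> separating d = {}"
    using reflection_subgroup_fundamental_domain[OF R(2) z] by blast
  have h: "h \<in> carrier G" using generate_in_carrier[OF RG] hd by blast
  define X Y where "X = sym_diff (separating x) (separating z)" and "Y = sym_diff (separating z) (separating y)"
  have fin: "finite X" "finite Y" by (auto simp: X_def Y_def)
  have "wall_dist x y \<le> card (X \<union> Y - X \<inter> Y)"
    unfolding wall_dist_def by (intro card_mono) (auto simp: X_def Y_def)
  also have "\<dots> = card (X \<union> Y) - card (X \<inter> Y)"
    using fin by (intro card_Diff_subset) auto
  finally have le: "wall_dist x y \<le> card (X \<union> Y) - card (X \<inter> Y)" .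
  have "wall_dist x z = card X" "wall_dist z y = card Y"
    by (simp_all add: wall_dist_def X_def Y_def)
  with between le card_Un_Int[OF fin] have "card (X \<inter> Y) = 0" by linarith
  then have XY: "X \<inter> Y = {}" using fin by auto
  have "separating d \<subseteq> (\<Union>r\<in>R. separating r)"
  proof
    fix K assume K: "K \<in> separating d"
    then have Kc: "K \<in> carrier G" using separating_closed hd by blast
    have mem: "conjugate h K \<in> separating (h \<otimes> g) \<longleftrightarrow> (conjugate h K \<in> separating h) \<noteq> (K \<in> separating g)"
      if "g \<in> carrier G" for g using conjugate_mem_separating_mult[of h g K] h Kc that by simp
    have h': "inv h \<in> generate G R" using generate_m_inv_closed[OF RG] hd by blast
    have gen: "inv h \<otimes> g \<in> generate G R" if "g \<in> generate G R" for g
      using h' that by (rule generate.eng)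
    have "conjugate h K \<notin> X \<or> conjugate h K \<notin> Y" using XY by blast
    then have "K \<in> separating (inv h \<otimes> x) \<or> K \<in> separating (inv h \<otimes> y)"
      using mem[of d] mem[of "inv h \<otimes> x"] mem[of "inv h \<otimes> y"] K h hd c
      by (auto simp: X_def Y_def simp flip: m_assoc)
    then show "K \<in> (\<Union>r\<in>R. separating r)"
      using separating_wall_near_generator[OF R(2,3) hd(2,4) _ K] gen xy by blast
  qed
  then have "card (separating d) \<le> card (\<Union>r\<in>R. separating r)"
    using R by (intro card_mono) auto
  also have "\<dots> \<le> (\<Sum>r\<in>R. card (separating r))" using R by (intro card_UN_le) auto
  also have "card (separating d) = wall_dist z h"
    using wall_dist_eq[of h z] h z hd by (simp add: wall_dist_sym flip: m_assoc)
  finally show ?thesis using hd by blast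
qed

section \<open>Quasiconvexity in the Cayley graph\<close>

lemma wall_dist_self [simp]: "wall_dist x x = 0"
  by (simp add: wall_dist_def)

lemma wall_dist_triangle: "wall_dist x z \<le> wall_dist x y + wall_dist y z"
proof -
  have "wall_dist x z \<le> card (sym_diff (separating x) (separating y) \<union> sym_diff (separating y) (separating z))"
    unfolding wall_dist_def by (intro card_mono) auto
  also have "\<dots> \<le> wall_dist x y + wall_dist y z" unfolding wall_dist_def by (rule card_Un_le)
  finally show ?thesis .
qed

lemma cayley_arc_wall_dist:
  assumes "(g, h) \<in> parcs (cayley_graph G S)"
  shows "wall_dist g h = 1"
proof -
  have step: "wall_dist g (g \<otimes> s) = 1" if "g \<in> carrier G" "s \<in> S" for g s
    using that by (simp add: wall_dist_eq flip: m_assoc)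
  from assms obtain s where s: "g \<in> carrier G" "h \<in> carrier G" "s \<in> S" "h = g \<otimes> s \<or> g = h \<otimes> s"
    unfolding cayley_graph_def by auto
  from s(4) show ?thesis
  proof
    assume "g = h \<otimes> s"
    then show ?thesis using step[of h s] s(2,3) wall_dist_sym[of g h] by simp
  qed (use step s(1,3) in simp)
qed

lemma walk_wall_dist:
  assumes "pcas x p y" "set p \<subseteq> parcs (cayley_graph G S)"
  shows "wall_dist x y \<le> length p"
  using assms
proof (induction p arbitrary: x)
  case (Cons e p)
  then have "wall_dist x (snd e) = 1" "wall_dist (snd e) y \<le> length p"
    using cayley_arc_wall_dist[of "fst e" "snd e"] by auto
  then show ?case using wall_dist_triangle[of x y "snd e"] by simp
qed simp

lemma walk_vertex_wall_dist:
  assumes "pcas x p y" "set p \<subseteq> parcs (cayley_graph G S)" "z \<in> set (pawalk_verts x p)"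
  shows "wall_dist x z + wall_dist z y \<le> length p"
  using assms
proof (induction p arbitrary: x)
  case (Cons e p)
  show ?case
  proof (cases "z = x")
    case True
    then show ?thesis using walk_wall_dist[OF Cons.prems(1,2)] by simp
  next
    case False
    then have "wall_dist (snd e) z + wall_dist z y \<le> length p" using Cons by auto
    moreover have "wall_dist x (snd e) = 1"
      using Cons.prems cayley_arc_wall_dist[of "fst e" "snd e"] by auto
    ultimately show ?thesis using wall_dist_triangle[of x z "snd e"] by simp
  qed
qed simp

lemma walk_of_word:
  assumes "w \<in> lists S" "x \<in> carrier G"
  shows "\<exists>p. pcas x p (x \<otimes> word_value G w) \<and> set p \<subseteq> parcs (cayley_graph G S) \<and> length p = length w"
  using assms
proof (induction w arbitrary: x rule: list.induct)
  case Nil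
  then show ?case by (intro exI[of _ "[]"]) simp
next
  case (Cons s w)
  have sw: "s \<in> S" "w \<in> lists S" using Cons.prems by auto
  with Cons obtain p where p: "pcas (x \<otimes> s) p ((x \<otimes> s) \<otimes> word_value G w)"
    "set p \<subseteq> parcs (cayley_graph G S)" "length p = length w" by (meson gen_closed m_closed)
  have "word_value G w \<in> carrier G" using sw by simp
  moreover have "(x, x \<otimes> s) \<in> parcs (cayley_graph G S)"
    using sw Cons.prems by (auto simp: cayley_graph_def)
  ultimately show ?case
    using p sw Cons.prems by (intro exI[of _ "(x, x \<otimes> s) # p"]) (simp add: m_assoc)
qed

lemma awalk_cayley_iff:
  "pre_digraph.awalk (with_proj (cayley_graph G S)) x p y \<longleftrightarrow>
    x \<in> carrier G \<and> set p \<subseteq> parcs (cayley_graph G S) \<and> pcas x p y"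
  by (simp add: pre_digraph.awalk_def cas_with_proj_eq) (simp add: cayley_graph_def)

lemma graph_dist_le_wall_dist:
  assumes "x \<in> carrier G" "y \<in> carrier G"
  shows "graph_dist (cayley_graph G S) x y \<le> ereal (real (wall_dist x y))"
proof -
  interpret C: pair_wf_digraph "cayley_graph G S" by (rule pair_wf_digraph_cayley_graph)
  obtain w where w: "w \<in> lists S" "word_value G w = inv x \<otimes> y"
    "length w = card (separating (inv x \<otimes> y))"
    by (rule reduced_word[of "inv x \<otimes> y"]) (use assms in auto)
  obtain p where p: "pcas x p (x \<otimes> word_value G w)" "set p \<subseteq> parcs (cayley_graph G S)"
    "length p = length w" using walk_of_word[OF w(1) assms(1)] by blast
  have "x \<otimes> word_value G w = y" using w assms by (simp flip: m_assoc)
  then have "C.awalk x p y" using p assms by (simp add: awalk_cayley_iff)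
  then have "C.\<mu> (\<lambda>_. 1) x y \<le> ereal (C.awalk_cost (\<lambda>_. 1) p)"
    by (rule C.min_cost_le_walk_cost)
  also have "C.awalk_cost (\<lambda>_. 1) p = real (length p)"
    by (induction p) (simp_all add: C.awalk_cost_def)
  finally show ?thesis using p w wall_dist_eq[OF assms] by (simp add: graph_dist_def)
qed

lemma reflection_subgroup_quasiconvex:
  assumes "finite R" "R \<subseteq> reflections"
  shows "quasiconvex G S (generate G R)"
proof -
  obtain R' where R': "finite R'" "R' \<subseteq> reflections" "generate G R' = generate G R" "facing R'"
    using facing_generators_exist[OF assms] by blast
  let ?M = "\<Sum>r\<in>R'. card (separating r)"
  have carrier: "generate G R \<subseteq> carrier G"
    using assms by (intro generate_incl) auto
  have "\<exists>h\<in>generate G R. graph_dist (cayley_graph G S) z h \<le> ereal (real ?M)"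
    if gen: "x \<in> generate G R" "y \<in> generate G R" and p: "geodesic (cayley_graph G S) x p y"
      and zp: "z \<in> set (pawalk_verts x p)" for x y p z
  proof -
    have xy: "x \<in> carrier G" "y \<in> carrier G" using gen carrier by auto
    have p: "pcas x p y" "set p \<subseteq> parcs (cayley_graph G S)"
      and len: "ereal (real (length p)) = graph_dist (cayley_graph G S) x y"
      using p by (auto simp: geodesic_def awalk_cayley_iff)
    have z: "z \<in> carrier G"
      using p zp xy(1)
    proof (induction p arbitrary: x)
      case (Cons e p)
      then have "fst e \<in> carrier G" "snd e \<in> carrier G" by (auto simp: cayley_graph_def)
      with Cons show ?case by auto
    qed simp
    have "length p \<le> wall_dist x y"
      using graph_dist_le_wall_dist[OF xy] by (simp flip: len)
    then have "wall_dist x z + wall_dist z y \<le> wall_dist x y"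
      using walk_vertex_wall_dist[OF p zp] by simp
    then obtain h where h: "h \<in> generate G R" "wall_dist z h \<le> ?M"
      using reflection_subgroup_near_geodesics[of R' x y z] R' gen z by auto
    have "graph_dist (cayley_graph G S) z h \<le> ereal (real (wall_dist z h))"
      using graph_dist_le_wall_dist z h carrier by blast
    also have "\<dots> \<le> ereal (real ?M)"
      using of_nat_mono[OF h(2), where 'a = real] by (simp only: ereal_less_eq)
    finally show ?thesis using h by blast
  qed
  then show ?thesis
    unfolding quasiconvex_def by (intro exI[of _ "real ?M"] conjI of_nat_0_le_iff) blast
qed

text \<open>The reflections to use are those among the elements of \<open>A\<close> and their pairwise products.\<close>

lemma generated_by_reflections:
  assumes "no_commuting_triple" and A: "finite A" "A \<subseteq> carrier G"
    and involution: "\<And>x. x \<in> A \<Longrightarrow> x \<otimes> x = \<one> \<and> x \<noteq> \<one>"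
    and neighbour: "\<And>x. x \<in> A \<Longrightarrow> \<exists>y\<in>A. x \<noteq> y \<and> x \<otimes> y = y \<otimes> x"
  shows "\<exists>R. finite R \<and> R \<subseteq> reflections \<and> generate G R = generate G A"
proof (intro exI conjI)
  let ?R = "reflections \<inter> (A \<union> (\<lambda>(x, y). x \<otimes> y) ` (A \<times> A))"
  show "finite ?R" using A by simp
  show "?R \<subseteq> reflections" by blast
  have "?R \<subseteq> generate G A" by (auto intro: generate.intros)
  then have "generate G ?R \<subseteq> generate G A"
    using A by (intro generate_subgroup_incl generate_is_subgroup)
  moreover have "x \<in> generate G ?R" if x: "x \<in> A" for x
  proof -
    obtain y where y: "y \<in> A" "x \<noteq> y" "x \<otimes> y = y \<otimes> x" using neighbour x by blast
    have c: "x \<in> carrier G" "y \<in> carrier G" using A x y by auto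
    from reflection_or_neighbour_reflection[OF assms(1) c(1) _ _ c(2)] involution x y
    consider "x \<in> reflections" | "y \<in> reflections" "x \<otimes> y \<in> reflections" by blast
    then show ?thesis
    proof cases
      case 1
      then show ?thesis using x by (auto intro: generate.incl)
    next
      case 2
      then have "y \<in> ?R" "x \<otimes> y \<in> ?R" using x y(1) by auto
      then have "(x \<otimes> y) \<otimes> y \<in> generate G ?R" by (intro generate.eng generate.incl)
      moreover have "(x \<otimes> y) \<otimes> y = x" using c involution[of y] y(1) by (simp add: m_assoc)
      ultimately show ?thesis by simp
    qed
  qed
  moreover have "?R \<subseteq> carrier G" by auto
  ultimately show "generate G ?R = generate G A"
    using generate_subgroup_incl[OF _ generate_is_subgroup, of A ?R] by blast
qed

end

section \<open>The presentation of a right-angled Coxeter group\<close>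

lemma racg_carrier:
  "carrier (racg \<Gamma>) = (\<lambda>w. pres_rel (pverts \<Gamma>) (racg_relations \<Gamma>) `` {w}) ` words (pverts \<Gamma>)"
  by (auto simp: racg_def presented_group_def quotient_def)

lemma racg_one: "\<one>\<^bsub>racg \<Gamma>\<^esub> = pres_rel (pverts \<Gamma>) (racg_relations \<Gamma>) `` {[]}"
  by (simp add: racg_def presented_group_def)

lemma group_racg: "Group.group (racg \<Gamma>)"
  unfolding racg_def by (rule group_presented_group)

definition vertex_gen :: "'v pair_pre_digraph \<Rightarrow> 'v \<Rightarrow> 'v word set" where
  "vertex_gen \<Gamma> s = pres_rel (pverts \<Gamma>) (racg_relations \<Gamma>) `` {[(s, True)]}"

lemma racg_generators_eq: "racg_generators \<Gamma> = vertex_gen \<Gamma> ` pverts \<Gamma>"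
  by (simp add: racg_generators_def generators_def vertex_gen_def)

lemma vertex_gen_closed: "s \<in> pverts \<Gamma> \<Longrightarrow> vertex_gen \<Gamma> s \<in> carrier (racg \<Gamma>)"
  by (auto simp: racg_carrier vertex_gen_def)

lemma vertex_gen_square:
  assumes "s \<in> pverts \<Gamma>"
  shows "vertex_gen \<Gamma> s \<otimes>\<^bsub>racg \<Gamma>\<^esub> vertex_gen \<Gamma> s = \<one>\<^bsub>racg \<Gamma>\<^esub>"
proof -
  have "(positive_word [s, s], []) \<in> racg_relations \<Gamma>" using assms by (auto simp: racg_relations_def)
  from pres_eq.relation[OF this, of "[]" "pverts \<Gamma>" "[]"] assms
  have "pres_eq (pverts \<Gamma>) (racg_relations \<Gamma>) [(s, True), (s, True)] []" by (simp add: positive_word_def)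
  then show ?thesis
    using assms by (simp add: vertex_gen_def racg_def presented_group_mult pres_class_eq_iff
      racg_one[unfolded racg_def])
qed

lemma vertex_gen_commute:
  assumes "(s, t) \<in> parcs \<Gamma>" "s \<in> pverts \<Gamma>" "t \<in> pverts \<Gamma>"
  shows "vertex_gen \<Gamma> s \<otimes>\<^bsub>racg \<Gamma>\<^esub> vertex_gen \<Gamma> t = vertex_gen \<Gamma> t \<otimes>\<^bsub>racg \<Gamma>\<^esub> vertex_gen \<Gamma> s"
proof -
  have "(positive_word [s, t], positive_word [t, s]) \<in> racg_relations \<Gamma>"
    using assms by (auto simp: racg_relations_def)
  from pres_eq.relation[OF this, of "[]" "pverts \<Gamma>" "[]"] assms
  have "pres_eq (pverts \<Gamma>) (racg_relations \<Gamma>) [(s, True), (t, True)] [(t, True), (s, True)]"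
    by (simp add: positive_word_def)
  then show ?thesis
    using assms by (simp add: vertex_gen_def racg_def presented_group_mult pres_class_eq_iff)
qed

text \<open>In \<open>racg \<Gamma>\<close> a generator and its formal inverse have the same class, so the signs of letters can be
  dropped.\<close>

lemma racg_letter:
  assumes "s \<in> pverts \<Gamma>"
  shows "pres_rel (pverts \<Gamma>) (racg_relations \<Gamma>) `` {[(s, b)]} = vertex_gen \<Gamma> s"
proof (cases b)
  case False
  interpret W: Group.group "racg \<Gamma>" by (rule group_racg)
  let ?x = "pres_rel (pverts \<Gamma>) (racg_relations \<Gamma>) `` {[(s, b)]}"
  have x: "?x \<in> carrier (racg \<Gamma>)" using assms by (auto simp: racg_carrier)
  have "pres_eq (pverts \<Gamma>) (racg_relations \<Gamma>) ([] @ [(s, True), (s, \<not> True)] @ []) ([] @ [])"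
    using assms by (intro pres_eq.cancel) auto
  then have "vertex_gen \<Gamma> s \<otimes>\<^bsub>racg \<Gamma>\<^esub> ?x = \<one>\<^bsub>racg \<Gamma>\<^esub>"
    using assms False by (simp add: vertex_gen_def racg_def presented_group_mult pres_class_eq_iff
      racg_one[unfolded racg_def])
  with vertex_gen_square[OF assms] show ?thesis
    using x vertex_gen_closed[OF assms] by (metis W.inv_equality W.inv_inv)
qed (simp add: vertex_gen_def)

lemma racg_word_value:
  assumes "w \<in> words (pverts \<Gamma>)"
  shows "word_value (racg \<Gamma>) (map (\<lambda>x. vertex_gen \<Gamma> (fst x)) w) =
    pres_rel (pverts \<Gamma>) (racg_relations \<Gamma>) `` {w}"
  using assms
proof (induction w rule: list.induct)
  case (Cons x w)
  obtain s b where x: "x = (s, b)" by force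
  have sw: "s \<in> pverts \<Gamma>" "w \<in> words (pverts \<Gamma>)" using Cons.prems x by auto
  then have "word_value (racg \<Gamma>) (map (\<lambda>x. vertex_gen \<Gamma> (fst x)) (x # w)) =
      pres_rel (pverts \<Gamma>) (racg_relations \<Gamma>) `` {[(s, b)]} \<otimes>\<^bsub>racg \<Gamma>\<^esub>
      pres_rel (pverts \<Gamma>) (racg_relations \<Gamma>) `` {w}"
    using Cons.IH by (simp add: word_value_def x racg_letter)
  also have "\<dots> = pres_rel (pverts \<Gamma>) (racg_relations \<Gamma>) `` {x # w}"
    unfolding racg_def using sw by (subst presented_group_mult) (auto simp: x)
  finally show ?case .
qed (simp add: word_value_def racg_one)

text \<open>After the signs are dropped, both free cancellation and the relation \<open>s\<^sup>2 = 1\<close> become the cancellation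
  of a repeated letter.\<close>

lemma pres_eq_shuffle_equiv:
  assumes "pres_eq (pverts \<Gamma>) (racg_relations \<Gamma>) u v"
  shows "shuffle_equiv (racg \<Gamma>) (racg_generators \<Gamma>)
    (map (\<lambda>x. vertex_gen \<Gamma> (fst x)) u) (map (\<lambda>x. vertex_gen \<Gamma> (fst x)) v)"
proof -
  have gens: "map (\<lambda>x. vertex_gen \<Gamma> (fst x)) w \<in> lists (racg_generators \<Gamma>)" if "w \<in> words (pverts \<Gamma>)" for w
    using that by (auto simp: racg_generators_eq in_lists_conv_set)
  have vertex: "vertex_gen \<Gamma> s \<in> racg_generators \<Gamma>" if "s \<in> pverts \<Gamma>" for s
    using that by (simp add: racg_generators_eq)
  from assms show ?thesis
  proof induction
    case (refl w)
    then show ?case using gens by (intro shuffle_refl)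
  next
    case (sym v w)
    show ?case using sym.IH by (rule shuffle_sym)
  next
    case (trans u v w)
    show ?case using trans.IH by (rule shuffle_trans)
  next
    case (cancel u v s b)
    then show ?case
      using shuffle_cancel[OF gens[of u] gens[of v] vertex[of s]] by simp
  next
    case (relation l r u v)
    from relation(1) consider s where "l = positive_word [s, s]" "r = []"
      | s t where "(s, t) \<in> parcs \<Gamma>" "l = positive_word [s, t]" "r = positive_word [t, s]"
      by (auto simp: racg_relations_def)
    then show ?case
    proof cases
      case (1 s)
      then show ?thesis using relation
        shuffle_cancel[OF gens[of u] gens[of v] vertex[of s]] by (simp add: positive_word_def)
    next
      case (2 s t)
      then have "s \<in> pverts \<Gamma>" "t \<in> pverts \<Gamma>" using relation by (auto simp: positive_word_def)
      with 2 relation show ?thesis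
        using shuffle_swap[OF gens[of u] gens[of v] vertex[of s] vertex[of t] vertex_gen_commute]
        by (simp add: positive_word_def)
    qed
  qed
qed

lemma racg_right_angled_coxeter_system:
  "right_angled_coxeter_system (racg \<Gamma>) (racg_generators \<Gamma>)"
proof -
  interpret W: Group.group "racg \<Gamma>" by (rule group_racg)
  have gen_word: "\<exists>u'\<in>words (pverts \<Gamma>). u = map (\<lambda>x. vertex_gen \<Gamma> (fst x)) u'"
    if "u \<in> lists (racg_generators \<Gamma>)" for u
    using that
  proof (induction u rule: list.induct)
    case (Cons g u)
    then have "g \<in> racg_generators \<Gamma>" "u \<in> lists (racg_generators \<Gamma>)" by auto
    moreover from this Cons.IH obtain u' where "u' \<in> words (pverts \<Gamma>)"
      "u = map (\<lambda>x. vertex_gen \<Gamma> (fst x)) u'" by blast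
    moreover obtain s where "s \<in> pverts \<Gamma>" "g = vertex_gen \<Gamma> s"
      using calculation(1) by (auto simp: racg_generators_eq)
    ultimately show ?case by (intro bexI[of _ "(s, True) # u'"]) auto
  qed auto
  show ?thesis
  proof
    show "racg_generators \<Gamma> \<subseteq> carrier (racg \<Gamma>)"
      by (auto simp: racg_generators_eq vertex_gen_closed)
    show "s \<otimes>\<^bsub>racg \<Gamma>\<^esub> s = \<one>\<^bsub>racg \<Gamma>\<^esub>" if "s \<in> racg_generators \<Gamma>" for s
      using that by (auto simp: racg_generators_eq vertex_gen_square)
    show "\<exists>w\<in>lists (racg_generators \<Gamma>). word_value (racg \<Gamma>) w = g" if g: "g \<in> carrier (racg \<Gamma>)" for g
    proof -
      obtain w where w: "w \<in> words (pverts \<Gamma>)"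
        "g = pres_rel (pverts \<Gamma>) (racg_relations \<Gamma>) `` {w}" using g by (auto simp: racg_carrier)
      have "map (\<lambda>x. vertex_gen \<Gamma> (fst x)) w \<in> lists (racg_generators \<Gamma>)"
        using w by (auto simp: racg_generators_eq in_lists_conv_set)
      then show ?thesis using racg_word_value[OF w(1)] w(2) by blast
    qed
    show "shuffle_equiv (racg \<Gamma>) (racg_generators \<Gamma>) u v"
      if uS: "u \<in> lists (racg_generators \<Gamma>)" and vS: "v \<in> lists (racg_generators \<Gamma>)"
        and eq: "word_value (racg \<Gamma>) u = word_value (racg \<Gamma>) v" for u v
    proof -
      obtain u' v' where uv: "u' \<in> words (pverts \<Gamma>)" "u = map (\<lambda>x. vertex_gen \<Gamma> (fst x)) u'"
        "v' \<in> words (pverts \<Gamma>)" "v = map (\<lambda>x. vertex_gen \<Gamma> (fst x)) v'"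
        using gen_word[OF uS] gen_word[OF vS] by blast
      with eq have "pres_eq (pverts \<Gamma>) (racg_relations \<Gamma>) u' v'"
        by (simp add: racg_word_value pres_class_eq_iff)
      with uv show ?thesis using pres_eq_shuffle_equiv by blast
    qed
  qed
qed

text \<open>The universal property of the presentation, for actions by involutions. It detects that words are
  different.\<close>

lemma racg_compose_along_invariant:
  assumes "pres_eq (pverts \<Gamma>) (racg_relations \<Gamma>) u v"
    and square: "\<And>s. f s \<circ> f s = id"
    and commute: "\<And>s t. (s, t) \<in> parcs \<Gamma> \<Longrightarrow> f s \<circ> f t = f t \<circ> f s"
  shows "compose_along (\<lambda>x. f (fst x)) u = compose_along (\<lambda>x. f (fst x)) v"
  using assms(1)
proof induction
  case (cancel u v s b)
  have "f s (f s y) = y" for y using square[of s] by (simp add: fun_eq_iff)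
  then show ?case by (simp add: fun_eq_iff)
next
  case (relation l r u v)
  have "compose_along (\<lambda>x. f (fst x)) l = compose_along (\<lambda>x. f (fst x)) r"
    using relation(1) square commute by (auto simp: racg_relations_def positive_word_def)
  then show ?case by (simp add: fun_eq_iff)
qed auto

text \<open>For vertices that are not adjacent, \<open>racg \<Gamma>\<close> acts on the integers with \<open>s\<close> and \<open>t\<close> as two reflections
  that do not commute and the other vertices trivially.\<close>

lemma vertex_gens_commute_imp_adjacent:
  assumes "s \<in> pverts \<Gamma>" "t \<in> pverts \<Gamma>" "s \<noteq> t"
    and "vertex_gen \<Gamma> s \<otimes>\<^bsub>racg \<Gamma>\<^esub> vertex_gen \<Gamma> t = vertex_gen \<Gamma> t \<otimes>\<^bsub>racg \<Gamma>\<^esub> vertex_gen \<Gamma> s"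
  shows "(s, t) \<in> parcs \<Gamma> \<or> (t, s) \<in> parcs \<Gamma>"
proof (rule ccontr)
  assume nonadjacent: "\<not> ?thesis"
  define f :: "'a \<Rightarrow> int \<Rightarrow> int" where
    "f = (\<lambda>v. if v = s then uminus else if v = t then (-) 1 else id)"
  have "pres_eq (pverts \<Gamma>) (racg_relations \<Gamma>) [(s, True), (t, True)] [(t, True), (s, True)]"
    using assms by (simp add: vertex_gen_def racg_def presented_group_mult pres_class_eq_iff)
  then have "compose_along (\<lambda>x. f (fst x)) [(s, True), (t, True)] =
      compose_along (\<lambda>x. f (fst x)) [(t, True), (s, True)]"
    by (rule racg_compose_along_invariant) (use nonadjacent in \<open>auto simp: f_def fun_eq_iff\<close>)
  then show False using assms(3) by (auto simp: f_def fun_eq_iff)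
qed

text \<open>The parity of the number of occurrences of \<open>s\<close> in a word is an invariant of its class.\<close>

lemma vertex_gen_neq:
  assumes "s \<in> pverts \<Gamma>"
  shows "vertex_gen \<Gamma> s \<noteq> \<one>\<^bsub>racg \<Gamma>\<^esub>"
    and "t \<in> pverts \<Gamma> \<Longrightarrow> s \<noteq> t \<Longrightarrow> vertex_gen \<Gamma> s \<noteq> vertex_gen \<Gamma> t"
proof -
  define f :: "'a \<Rightarrow> bool \<Rightarrow> bool" where "f = (\<lambda>v. if v = s then Not else id)"
  have "\<not> pres_eq (pverts \<Gamma>) (racg_relations \<Gamma>) [(s, True)] w"
    if "compose_along (\<lambda>x. f (fst x)) w = id" for w
  proof
    assume "pres_eq (pverts \<Gamma>) (racg_relations \<Gamma>) [(s, True)] w"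
    then have "compose_along (\<lambda>x. f (fst x)) [(s, True)] = compose_along (\<lambda>x. f (fst x)) w"
      by (rule racg_compose_along_invariant) (auto simp: f_def fun_eq_iff)
    with that show False by (simp add: f_def fun_eq_iff)
  qed
  note neq = this
  show "vertex_gen \<Gamma> s \<noteq> \<one>\<^bsub>racg \<Gamma>\<^esub>"
    using neq[of "[]"] assms by (simp add: vertex_gen_def racg_one pres_class_eq_iff)
  show "vertex_gen \<Gamma> s \<noteq> vertex_gen \<Gamma> t" if "t \<in> pverts \<Gamma>" "s \<noteq> t"
    using neq[of "[(t, True)]"] assms that by (simp add: vertex_gen_def pres_class_eq_iff f_def)
qed

lemma triangle_free_no_commuting_triple:
  assumes "pair_graph \<Gamma>" and "triangle_free \<Gamma>"
  shows "right_angled_coxeter_system.no_commuting_triple (racg \<Gamma>) (racg_generators \<Gamma>)"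
proof -
  interpret \<Gamma>: pair_graph \<Gamma> by fact
  interpret W: right_angled_coxeter_system "racg \<Gamma>" "racg_generators \<Gamma>"
    by (rule racg_right_angled_coxeter_system)
  have "sym (parcs \<Gamma>)" using \<Gamma>.pair_sym_arcs by (simp add: symmetric_def)
  then have adjacent: "(a, b) \<in> parcs \<Gamma>"
    if "a \<in> pverts \<Gamma>" "b \<in> pverts \<Gamma>" "vertex_gen \<Gamma> a \<noteq> vertex_gen \<Gamma> b"
      "vertex_gen \<Gamma> a \<otimes>\<^bsub>racg \<Gamma>\<^esub> vertex_gen \<Gamma> b = vertex_gen \<Gamma> b \<otimes>\<^bsub>racg \<Gamma>\<^esub> vertex_gen \<Gamma> a"
    for a b
    using vertex_gens_commute_imp_adjacent[OF that(1,2) _ that(4)] that(3) by (auto dest: symD)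
  show ?thesis
    unfolding W.no_commuting_triple_def unfolding racg_generators_eq
  proof (intro notI, elim bexE imageE conjE)
    fix s t u a b c
    assume abc: "a \<in> pverts \<Gamma>" "s = vertex_gen \<Gamma> a" "b \<in> pverts \<Gamma>" "t = vertex_gen \<Gamma> b"
      "c \<in> pverts \<Gamma>" "u = vertex_gen \<Gamma> c" and neq: "s \<noteq> t" "s \<noteq> u" "t \<noteq> u"
      and comm: "s \<otimes>\<^bsub>racg \<Gamma>\<^esub> t = t \<otimes>\<^bsub>racg \<Gamma>\<^esub> s" "s \<otimes>\<^bsub>racg \<Gamma>\<^esub> u = u \<otimes>\<^bsub>racg \<Gamma>\<^esub> s"
        "t \<otimes>\<^bsub>racg \<Gamma>\<^esub> u = u \<otimes>\<^bsub>racg \<Gamma>\<^esub> t"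
    have "(a, b) \<in> parcs \<Gamma>" "(b, c) \<in> parcs \<Gamma>" "(a, c) \<in> parcs \<Gamma>"
      using adjacent[of a b] adjacent[of b c] adjacent[of a c] abc(1,3,5) neq comm
      unfolding abc(2,4,6) by blast+
    then show False using assms(2) unfolding triangle_free_def by blast
  qed
qed

lemma iso_subgroup_generated:
  assumes "right_angled_coxeter_system D S" and "Group.group W" and H: "subgroup H W"
    and \<phi>: "\<phi> \<in> iso D (W\<lparr>carrier := H\<rparr>)"
  shows "\<phi> \<one>\<^bsub>D\<^esub> = \<one>\<^bsub>W\<^esub>" and "H = generate W (\<phi> ` S)"
proof -
  interpret D: right_angled_coxeter_system D S by fact
  interpret W: Group.group W by fact
  have closed: "\<phi> x \<in> H" if "x \<in> carrier D" for x
    using \<phi> that by (auto simp: iso_def hom_def)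
  have mult: "\<phi> (x \<otimes>\<^bsub>D\<^esub> y) = \<phi> x \<otimes>\<^bsub>W\<^esub> \<phi> y" if "x \<in> carrier D" "y \<in> carrier D" for x y
    using \<phi> that by (auto simp: iso_def hom_def)
  have surj: "\<phi> ` carrier D = H" using \<phi> by (simp add: iso_def bij_betw_def)
  have "\<phi> \<one>\<^bsub>D\<^esub> \<in> carrier W" using closed subgroup.mem_carrier[OF H] by simp
  moreover have "\<phi> \<one>\<^bsub>D\<^esub> \<otimes>\<^bsub>W\<^esub> \<phi> \<one>\<^bsub>D\<^esub> = \<phi> \<one>\<^bsub>D\<^esub>" using mult[of "\<one>\<^bsub>D\<^esub>" "\<one>\<^bsub>D\<^esub>"] by simp
  ultimately show one: "\<phi> \<one>\<^bsub>D\<^esub> = \<one>\<^bsub>W\<^esub>" using W.l_cancel_one by simp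
  have word: "\<phi> (word_value D w) \<in> generate W (\<phi> ` S)" if "w \<in> lists S" for w
    using that
  proof (induction w rule: list.induct)
    case Nil
    then show ?case by (simp add: one generate.one)
  next
    case (Cons s w)
    have sw: "s \<in> S" "w \<in> lists S" using Cons.prems by auto
    then have "\<phi> (word_value D (s # w)) = \<phi> s \<otimes>\<^bsub>W\<^esub> \<phi> (word_value D w)"
      by (simp add: mult)
    moreover have "\<phi> s \<in> generate W (\<phi> ` S)" using sw(1) by (intro generate.incl imageI)
    ultimately show ?case using Cons.IH[OF sw(2)] by (simp add: generate.eng)
  qed
  have "\<phi> x \<in> generate W (\<phi> ` S)" if "x \<in> carrier D" for x
    using D.gens_generate[OF that] word by blast
  with surj have "H \<subseteq> generate W (\<phi> ` S)" by blast
  moreover have "\<phi> ` S \<subseteq> H" using closed by auto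
  ultimately show "H = generate W (\<phi> ` S)" using W.generate_subgroup_incl H by blast
qed

theorem corollary11p5:
  fixes \<Gamma> :: "'v pair_pre_digraph" and \<Delta> :: "'w pair_pre_digraph" and H :: "'v word set set"
  assumes "pair_graph \<Gamma>" and "triangle_free \<Gamma>"
    and "coxeter_subgroup (racg \<Gamma>) H"
    and "defining_graph_of \<Delta> (racg \<Gamma>) H"
    and "\<not> (\<exists>v. isolated_vertex \<Delta> v)"
  shows "quasiconvex (racg \<Gamma>) (racg_generators \<Gamma>) H"
proof -
  interpret \<Delta>: pair_graph \<Delta> using assms(4) by (simp add: defining_graph_of_def)
  interpret W: right_angled_coxeter_system "racg \<Gamma>" "racg_generators \<Gamma>"
    by (rule racg_right_angled_coxeter_system)
  have H: "subgroup H (racg \<Gamma>)" using assms(3) by (simp add: coxeter_subgroup_def)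
  have "racg \<Gamma>\<lparr>carrier := H\<rparr> \<cong> racg \<Delta>" using assms(4) by (simp add: defining_graph_of_def)
  then have "racg \<Delta> \<cong> racg \<Gamma>\<lparr>carrier := H\<rparr>"
    by (rule group.iso_sym[OF W.subgroup_imp_group[OF H]])
  then obtain \<phi> where \<phi>: "\<phi> \<in> iso (racg \<Delta>) (racg \<Gamma>\<lparr>carrier := H\<rparr>)" by (auto simp: is_iso_def)
  note generated = iso_subgroup_generated[OF racg_right_angled_coxeter_system group_racg H \<phi>]
  have inj: "inj_on \<phi> (carrier (racg \<Delta>))" using \<phi> by (simp add: iso_def bij_betw_def)
  define g where "g = (\<lambda>v. \<phi> (vertex_gen \<Delta> v))"
  have mult: "g v \<otimes>\<^bsub>racg \<Gamma>\<^esub> g w = \<phi> (vertex_gen \<Delta> v \<otimes>\<^bsub>racg \<Delta>\<^esub> vertex_gen \<Delta> w)"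
    if "v \<in> pverts \<Delta>" "w \<in> pverts \<Delta>" for v w
    using \<phi> vertex_gen_closed[OF that(1)] vertex_gen_closed[OF that(2)]
    by (simp add: iso_def hom_def g_def)
  have gH: "g v \<in> H" if "v \<in> pverts \<Delta>" for v
    using \<phi> vertex_gen_closed[OF that] by (auto simp: iso_def hom_def g_def)
  have "\<exists>R. finite R \<and> R \<subseteq> W.reflections \<and> generate (racg \<Gamma>) R = generate (racg \<Gamma>) (g ` pverts \<Delta>)"
  proof (rule W.generated_by_reflections)
    show "W.no_commuting_triple" using assms(1,2) by (rule triangle_free_no_commuting_triple)
    show "finite (g ` pverts \<Delta>)" using \<Delta>.pair_finite_verts by simp
    show "g ` pverts \<Delta> \<subseteq> carrier (racg \<Gamma>)" using gH subgroup.mem_carrier[OF H] by blast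
  next
    fix x assume "x \<in> g ` pverts \<Delta>"
    then obtain v where v: "v \<in> pverts \<Delta>" "x = g v" by blast
    have "\<one>\<^bsub>racg \<Delta>\<^esub> \<in> carrier (racg \<Delta>)" by (auto simp: racg_one racg_carrier)
    then have "g v \<noteq> \<phi> \<one>\<^bsub>racg \<Delta>\<^esub>"
      unfolding g_def using inj_onD[OF inj] vertex_gen_closed[OF v(1)] vertex_gen_neq(1)[OF v(1)] by blast
    then show "x \<otimes>\<^bsub>racg \<Gamma>\<^esub> x = \<one>\<^bsub>racg \<Gamma>\<^esub> \<and> x \<noteq> \<one>\<^bsub>racg \<Gamma>\<^esub>"
      using mult[OF v(1) v(1)] v by (simp add: vertex_gen_square generated(1))
  next
    fix x assume "x \<in> g ` pverts \<Delta>"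
    then obtain v where v: "v \<in> pverts \<Delta>" "x = g v" by blast
    obtain w where w: "w \<noteq> v" "(v, w) \<in> parcs \<Delta>"
      using assms(5) v(1) by (auto simp: isolated_vertex_def)
    have wV: "w \<in> pverts \<Delta>" using \<Delta>.in_arcsD2 w(2) by blast
    have "g v \<noteq> g w"
      unfolding g_def using inj_onD[OF inj] vertex_gen_closed[OF v(1)] vertex_gen_closed[OF wV]
        vertex_gen_neq(2)[OF v(1) wV w(1)[symmetric]] by blast
    moreover have "g v \<otimes>\<^bsub>racg \<Gamma>\<^esub> g w = g w \<otimes>\<^bsub>racg \<Gamma>\<^esub> g v"
      using mult[OF v(1) wV] mult[OF wV v(1)] vertex_gen_commute[OF w(2) v(1) wV] by simp
    ultimately show "\<exists>y\<in>g ` pverts \<Delta>. x \<noteq> y \<and> x \<otimes>\<^bsub>racg \<Gamma>\<^esub> y = y \<otimes>\<^bsub>racg \<Gamma>\<^esub> x"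
      unfolding v(2) using wV by blast
  qed
  then obtain R where R: "finite R" "R \<subseteq> W.reflections"
    "generate (racg \<Gamma>) R = generate (racg \<Gamma>) (g ` pverts \<Delta>)" by blast
  have "g ` pverts \<Delta> = \<phi> ` racg_generators \<Delta>"
    by (simp add: g_def racg_generators_eq image_image)
  then have "H = generate (racg \<Gamma>) R" using R(3) generated(2) by simp
  then show ?thesis using W.reflection_subgroup_quasiconvex[OF R(1,2)] by simp
qed

end
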